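(* Let $f(x)=\mathbb{E}_\xi[f(x,\xi)]$ be convex and $L_0$-Lipschitz continuous on $\mathbb{R}^d$, with minimizer $x^*$. Suppose that $f(\cdot,\xi)$ is $L$-smooth and that for all $x\in\mathbb{R}^d$, $\mathbb{E}_\xi[(f(x,\xi)-f(x))^2]\le\sigma_0^2$ and $\mathbb{E}_\xi[\|\nabla f(x,\xi)-\nabla f(x)\|^2]\le\sigma_1^2$, where $\sigma_0,\sigma_1>0$. Run the stochastic one-point residual feedback algorithm from $x_1$ for $T$ iterations with smoothing parameter $\alpha>0$ and step size $0<\eta\le\min\left\{\frac{\alpha}{8dL_0},\frac{1}{64dL}\right\}$. Then $$\frac1T\sum_{t=1}^T\mathbb{E}\big[f(x_t)-f(x^* )\big]\le\frac{\|x_1-x^*\|^2}{\eta T}+20\eta d^2L^2\alpha^2+\frac{16\eta dL_0^2}{T}+\frac{L\alpha^2}{2}+\frac{128d^2\sigma_0^2\eta}{\alpha^2}+64d\eta\sigma_1^2 .$$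
   Context: $\|\cdot\|$ is the Euclidean norm on $\mathbb{R}^d$, $d\ge1$. A function $f$ is $L_0$-Lipschitz continuous ($L_0>0$) if $|f(x)-f(y)|\le L_0\|x-y\|$ for all $x,y$; it is $L$-smooth ($L>0$) if it is differentiable and $\|\nabla f(x)-\nabla f(y)\|\le L\|x-y\|$ for all $x,y$. $\xi$ is a random variable and $f(\cdot,\xi)$ is the random objective; "$f(\cdot,\xi)$ is $L$-smooth" means smooth in the first variable for every $\xi$, and $\nabla$ is the gradient in $x$. $x^*$ denotes a minimizer of $f$ over $\mathbb{R}^d$. Stochastic one-point residual feedback algorithm: given $x_1\in\mathbb{R}^d$, step size $\eta>0$, smoothing parameter $\alpha>0$ and iteration number $T$, set $x_0=x_1$, let $u_0,\dots,u_T$ be independent and uniformly distributed on the unit sphere of $\mathbb{R}^d$, let $\xi_0,\dots,\xi_T$ be independent copies of $\xi$, independent of the $u_t$, and for $t=1,\dots,T$ put $$\tilde g_t=d\cdot\frac{f(x_t+\alpha u_t,\xi_t)-f(x_{t-1}+\alpha u_{t-1},\xi_{t-1})}{\alpha}\,u_t,\qquad x_{t+1}=x_t-\eta\tilde g_t .$$ Expectations $\mathbb{E}$ are over all the $u_t,\xi_t$. *)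

theory Defs
  imports "HOL-Probability.Probability"
begin

definition gradient :: "('a::euclidean_space \<Rightarrow> real) \<Rightarrow> 'a \<Rightarrow> 'a" where
  "gradient f x = (THE g. GDERIV f x :> g)"

lemma gradient_eqI:
  assumes "GDERIV f x :> g"
  shows "gradient f x = g"
proof -
  have "h = g" if "GDERIV f x :> h" for h
  proof -
    have "(\<lambda>v. v \<bullet> h) = (\<lambda>v. v \<bullet> g)"
      using has_derivative_unique[of f] that assms unfolding gderiv_def by blast
    then have "(h - g) \<bullet> h = (h - g) \<bullet> g"
      by (rule fun_cong)
    then have "(h - g) \<bullet> (h - g) = 0"
      by (simp add: inner_diff_right)
    then show ?thesis
      by simp
  qed
  with assms show ?thesis
    unfolding gradient_def by (intro the_equality)
qed

lemma GDERIV_gradient: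
  fixes f :: "'a::euclidean_space \<Rightarrow> real"
  assumes "f differentiable (at x)"
  shows "GDERIV f x :> gradient f x"
proof -
  obtain D where D: "(f has_derivative D) (at x)"
    using assms by (auto simp: differentiable_def)
  then have lin: "linear D"
    by (rule has_derivative_linear)
  define g where "g = (\<Sum>b\<in>Basis. D b *\<^sub>R b)"
  have "D v = v \<bullet> g" for v
  proof -
    have "D v = D (\<Sum>b\<in>Basis. (v \<bullet> b) *\<^sub>R b)"
      by (simp add: euclidean_representation)
    also have "\<dots> = (\<Sum>b\<in>Basis. (v \<bullet> b) * D b)"
      by (simp add: linear_sum[OF lin] linear_scale[OF lin])
    also have "\<dots> = v \<bullet> g"
      by (simp add: g_def inner_sum_right mult.commute)
    finally show ?thesis .
  qed
  then have "D = (\<lambda>v. v \<bullet> g)" by blast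
  with D have "GDERIV f x :> g"
    unfolding gderiv_def by simp
  then show ?thesis
    using gradient_eqI by metis
qed

definition smooth_with :: "real \<Rightarrow> ('a::euclidean_space \<Rightarrow> real) \<Rightarrow> bool" where
  "smooth_with L f \<longleftrightarrow>
     (\<forall>x. f differentiable (at x)) \<and>
     (\<forall>x y. norm (gradient f x - gradient f y) \<le> L * norm (x - y))"

(* Normalized surface measure as a cone measure: the mass of a Borel set A of unit vectors
   is vol {r * a | 0 < r < 1, a in A} / vol (ball 0 1).  Here sgn x = x / norm x for x \<noteq> 0;
   the origin is a null set. *)
definition uniform_unit_sphere :: "'a::euclidean_space measure" where
  "uniform_unit_sphere = distr (uniform_measure lborel (ball 0 1)) borel sgn"

lemma prob_space_uniform_unit_sphere:
  "prob_space (uniform_unit_sphere :: 'a::euclidean_space measure)"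
proof -
  have fin: "emeasure lborel (ball (0::'a) 1) \<noteq> \<infinity>"
    using emeasure_lborel_ball_finite[of "0::'a" 1] by simp
  have pos: "emeasure lborel (ball (0::'a) 1) \<noteq> 0"
  proof -
    have "measure lborel (ball (0::'a) 1) > 0"
      using content_ball_pos[of 1 "0::'a"] by simp
    then show ?thesis
      by (auto simp: measure_def)
  qed
  have meas: "(sgn :: 'a \<Rightarrow> 'a) \<in> borel_measurable (uniform_measure lborel (ball 0 1))"
    unfolding sgn_div_norm[abs_def] by simp
  show ?thesis
    unfolding uniform_unit_sphere_def
    by (intro prob_space.prob_space_distr[OF _ meas] prob_space_uniform_measure fin pos)
qed

(* Version of indep_var for two random variables whose values have different types:
   independence of the generated sigma-algebras. *)
definition indep_pair ::
    "'w measure \<Rightarrow> 'b measure \<Rightarrow> ('w \<Rightarrow> 'b) \<Rightarrow> 'c measure \<Rightarrow> ('w \<Rightarrow> 'c) \<Rightarrow> bool" where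
  "indep_pair M S X S' Y \<longleftrightarrow>
     X \<in> measurable M S \<and> Y \<in> measurable M S' \<and>
     prob_space.indep_set M {X -` A \<inter> space M | A. A \<in> sets S} {Y -` B \<inter> space M | B. B \<in> sets S'}"

definition residual_estimate ::
    "('a::euclidean_space \<Rightarrow> 's \<Rightarrow> real) \<Rightarrow> real \<Rightarrow> 'a \<Rightarrow> 'a \<Rightarrow> 's \<Rightarrow> 'a \<Rightarrow> 'a \<Rightarrow> 's \<Rightarrow> 'a" where
  "residual_estimate F \<alpha> x u s x' u' s' =
     (real DIM('a) * ((F (x + \<alpha> *\<^sub>R u) s - F (x' + \<alpha> *\<^sub>R u') s') / \<alpha>)) *\<^sub>R u"

(* The estimate is only defined from t = 1 on, hence the two initial points x_0 = x_1. *)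
fun residual_iterate ::
    "('a::euclidean_space \<Rightarrow> 's \<Rightarrow> real) \<Rightarrow> real \<Rightarrow> real \<Rightarrow> 'a \<Rightarrow> (nat \<Rightarrow> 'a) \<Rightarrow> (nat \<Rightarrow> 's) \<Rightarrow> nat \<Rightarrow> 'a"
where
  "residual_iterate F \<alpha> \<eta> x1 u s 0 = x1"
| "residual_iterate F \<alpha> \<eta> x1 u s (Suc 0) = x1"
| "residual_iterate F \<alpha> \<eta> x1 u s (Suc (Suc n)) =
     residual_iterate F \<alpha> \<eta> x1 u s (Suc n) - \<eta> *\<^sub>R
       residual_estimate F \<alpha>
         (residual_iterate F \<alpha> \<eta> x1 u s (Suc n)) (u (Suc n)) (s (Suc n))
         (residual_iterate F \<alpha> \<eta> x1 u s n) (u n) (s n)"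

end

theory Submission
  imports Defs
begin

text \<open>Write \<open>\<Delta> t\<close> for the expected gap \<open>E (f (x t)) - f xstar\<close> and \<open>d\<close> for the dimension. The proof is
the usual descent argument for \<open>norm (x t - xstar)\<close>,

  \<open>E (norm (x (t+1) - xstar))\<^sup>2 = E (norm (x t - xstar))\<^sup>2 - 2 \<eta> E (g t \<bullet> (x t - xstar)) + E (norm (x (t+1) - x t))\<^sup>2\<close>,

with \<open>g t\<close> the residual estimate. It needs a lower bound of the inner product and an upper bound of
the increments that can be absorbed.

For the inner product, condition on the past. The previous observation, which the estimate subtracts,
then contributes nothing, because the uniform direction has mean \<open>0\<close>. What remains is \<open>d / \<alpha>\<close> times the spherical mean of
\<open>f (x + \<alpha> u) ((x - xstar) \<bullet> u)\<close>. By the divergence theorem on the ball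
(\<open>divergence_uniform_unit_sphere\<close>) this is the mean of \<open>(x - xstar) \<bullet> grad f (x + \<alpha> v)\<close> over the ball,
and convexity at each \<open>v\<close>, together with \<open>f (xstar + h) \<le> f xstar + L/2 (norm h)\<^sup>2\<close>, bounds it below by
\<open>f x - f xstar - L \<alpha>\<^sup>2 / 2\<close> (\<open>sphere_smoothing_descent\<close>, \<open>sample_descent\<close>). The loss \<open>L \<alpha>\<^sup>2 / 2\<close> does
not depend on \<open>norm (x - xstar)\<close>; a pointwise Taylor expansion of \<open>f\<close> would not give this.

For the increments, expand the observed value at \<open>x t\<close> as
\<open>f (x t) + noise t + \<alpha> slope t\<close> up to \<open>L \<alpha>\<^sup>2 / 2\<close>, where \<open>slope t\<close> is the derivative of the sampled
function in the direction \<open>u t\<close>. The square of the difference of two consecutive values then has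
four parts. In the mean, the noise contributes \<open>\<sigma>0\<^sup>2\<close>. The slope contributes only a fraction \<open>1 / d\<close> of the squared
gradient, since a random direction sees only that part of a fixed vector, and the mean squared gradient of a sample is
at most \<open>2 L \<Delta> t + \<sigma>1\<^sup>2\<close>. The Taylor remainder contributes \<open>L\<^sup>2 \<alpha>^4\<close>. The change of \<open>f\<close> between the two
iterates is at most \<open>L0\<close> times the previous increment, and \<open>\<eta> \<le> \<alpha> / (8 d L0)\<close> makes this a contraction
with factor \<open>1/16\<close> (\<open>increment_second_moment\<close>).

Summing over \<open>t\<close> (\<open>summed_descent_bound\<close>), the gaps enter the sum of the increments with a coefficient of
at most \<open>(16/15) 32 \<eta>\<^sup>2 d L \<le> (8/15) \<eta>\<close> and are absorbed by the \<open>2 \<eta>\<close> on the other side. The absorption is done for \<open>\<Delta> t - L \<alpha>\<^sup>2 / 2\<close> instead of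
\<open>\<Delta> t\<close>: in this way the bias \<open>L \<alpha>\<^sup>2 / 2\<close> enters the final bound once and is not multiplied by the
constant lost in the absorption. The gradient at the initial point, which occurs as that of
\<open>x 0\<close>, is bounded by \<open>L0\<close> and gives the term with \<open>L0\<^sup>2 / T\<close>.\<close>

section \<open>A divergence theorem on the unit ball\<close>

lemma lborel_integrable_affine:
  fixes h :: "'a::euclidean_space \<Rightarrow> real"
  assumes c: "c \<noteq> 0" and h: "integrable lborel h"
  shows "integrable lborel (\<lambda>v. h (t + c *\<^sub>R v))"
proof -
  have [measurable]: "h \<in> borel_measurable borel"
    using h by simp
  have "integrable (density (distr lborel borel (\<lambda>v. t + c *\<^sub>R v)) (\<lambda>_. \<bar>c\<bar> ^ DIM('a))) h"
    using h lborel_affine[OF c, of t] by simp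
  then show ?thesis
    using c by (simp add: integrable_density integrable_distr_eq)
qed

lemma lborel_integral_affine:
  fixes h :: "'a::euclidean_space \<Rightarrow> real"
  assumes c: "c \<noteq> 0" and h[measurable]: "h \<in> borel_measurable borel"
  shows "(\<integral>v. h v \<partial>lborel) = \<bar>c\<bar> ^ DIM('a) * (\<integral>v. h (t + c *\<^sub>R v) \<partial>lborel)"
proof -
  have "(\<integral>v. h v \<partial>lborel)
      = (\<integral>v. h v \<partial>density (distr lborel borel (\<lambda>v. t + c *\<^sub>R v)) (\<lambda>_. \<bar>c\<bar> ^ DIM('a)))"
    using lborel_affine[OF c, of t] by simp
  then show ?thesis
    by (simp add: integral_density integral_distr)
qed

lemma borel_measurable_sgn_euclidean [measurable]:
  "(sgn :: 'a::euclidean_space \<Rightarrow> 'a) \<in> borel_measurable borel"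
  unfolding sgn_div_norm[abs_def] by measurable

lemma ball_in_sets_borel [measurable]: "ball (c::'a::euclidean_space) r \<in> sets borel"
  by (intro borel_open open_ball)

text \<open>A function of \<open>sgn v\<close> alone is invariant under dilations, so its integral over a ball sees only the
volume scaling. This is all that is needed of polar coordinates.\<close>

lemma integral_ball_angular:
  fixes k :: "'a::euclidean_space \<Rightarrow> real"
  assumes "0 < r" and [measurable]: "k \<in> borel_measurable borel"
  shows "(\<integral>v. indicator (ball 0 r) v * k (sgn v) \<partial>lborel)
    = r ^ DIM('a) * (\<integral>v. indicator (ball 0 1) v * k (sgn v) \<partial>lborel)"
proof -
  have [measurable]: "(\<lambda>v. indicator (ball 0 r) v * k (sgn v)) \<in> borel_measurable borel"
    by measurable
  have "indicator (ball 0 r) (r *\<^sub>R v) = (indicator (ball 0 1) v :: real)" for v :: 'a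
    using \<open>0 < r\<close> by (auto simp: indicator_def field_simps)
  then show ?thesis
    using \<open>0 < r\<close>
    by (subst lborel_integral_affine[where c = r and t = 0]) (simp_all add: sgn_scaleR)
qed

lemma AE_norm_neq:
  fixes r :: real
  shows "AE v::'a::euclidean_space in lborel. norm v \<noteq> r"
proof -
  have "negligible (sphere (0::'a) r)"
    by (rule negligible_sphere)
  then have "sphere (0::'a) r \<in> null_sets lebesgue"
    by (simp add: negligible_iff_null_sets)
  then have "sphere (0::'a) r \<in> null_sets lborel"
    by (simp add: null_sets_completion_iff)
  then show ?thesis
    by (rule AE_I') auto
qed

lemma GDERIV_difference_quotient:
  assumes "GDERIV \<phi> v :> g"
  shows "(\<lambda>n. real (Suc n) * (\<phi> (v + (1 / real (Suc n)) *\<^sub>R w) - \<phi> v)) \<longlonglongrightarrow> w \<bullet> g"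
proof -
  have "((\<lambda>t. v + t *\<^sub>R w) has_derivative (\<lambda>t. t *\<^sub>R w)) (at 0)"
    by (auto intro!: derivative_eq_intros)
  moreover have "(\<phi> has_derivative (\<lambda>h. h \<bullet> g)) (at (v + 0 *\<^sub>R w))"
    using assms by (simp add: gderiv_def)
  ultimately have "((\<lambda>t. \<phi> (v + t *\<^sub>R w)) has_derivative (\<lambda>t. (t *\<^sub>R w) \<bullet> g)) (at 0)"
    by (rule has_derivative_compose)
  then have "((\<lambda>t. \<phi> (v + t *\<^sub>R w)) has_real_derivative w \<bullet> g) (at 0)"
    by (simp add: has_field_derivative_def mult_commute_abs)
  then have lim: "((\<lambda>t. (\<phi> (v + t *\<^sub>R w) - \<phi> v) / t) \<longlongrightarrow> w \<bullet> g) (at 0)"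
    by (simp add: DERIV_def)
  have "filterlim (\<lambda>n. 1 / real (Suc n)) (at 0) sequentially"
    unfolding filterlim_at
    using LIMSEQ_inverse_real_of_nat by (auto simp: inverse_eq_divide)
  from filterlim_compose[OF lim this] show ?thesis
    by (simp add: mult.commute)
qed

text \<open>Translation invariance of the Lebesgue measure: the difference quotients of \<open>\<phi>\<close> have integral \<open>0\<close>, and
the Lipschitz bound dominates them on a fixed ball. Differentiability almost everywhere is enough,
which admits the cutoff functions below that are only piecewise smooth.\<close>

lemma integral_directional_derivative_eq_0:
  fixes \<phi> :: "'a::euclidean_space \<Rightarrow> real"
  assumes lip: "C-lipschitz_on UNIV \<phi>"
    and supp: "\<And>v. 1 < norm v \<Longrightarrow> \<phi> v = 0"
    and deriv: "AE v in lborel. GDERIV \<phi> v :> g v"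
    and [measurable]: "g \<in> borel_measurable borel"
  shows "(\<integral>v. w \<bullet> g v \<partial>lborel) = 0"
proof -
  have cont: "continuous_on UNIV \<phi>"
    using lip by (rule lipschitz_on_continuous_on)
  then have [measurable]: "\<phi> \<in> borel_measurable borel"
    by (rule borel_measurable_continuous_onI)
  have int: "integrable lborel \<phi>"
  proof -
    have "integrable lborel (\<lambda>v. indicator (cball 0 1) v *\<^sub>R \<phi> v)"
      by (rule borel_integrable_compact) (auto intro: continuous_on_subset[OF cont])
    also have "(\<lambda>v. indicator (cball 0 1) v *\<^sub>R \<phi> v) = \<phi>"
      using supp by (auto simp: indicator_def fun_eq_iff)
    finally show ?thesis .
  qed
  define q where "q n v = real (Suc n) * (\<phi> (v + (1 / real (Suc n)) *\<^sub>R w) - \<phi> v)" for n v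
  have zero: "(\<integral>v. q n v \<partial>lborel) = 0" for n
  proof -
    let ?t = "(1 / real (Suc n)) *\<^sub>R w"
    have "integrable lborel (\<lambda>v. \<phi> (v + ?t))"
      using lborel_integrable_affine[OF _ int, of 1 ?t] by (simp add: add.commute)
    moreover have "(\<integral>v. \<phi> (v + ?t) \<partial>lborel) = (\<integral>v. \<phi> v \<partial>lborel)"
      using lborel_integral_affine[of 1 \<phi> ?t] by (simp add: add.commute)
    ultimately show ?thesis
      using int by (simp add: q_def)
  qed
  have "(\<lambda>n. \<integral>v. q n v \<partial>lborel) \<longlonglongrightarrow> (\<integral>v. w \<bullet> g v \<partial>lborel)"
  proof (rule integral_dominated_convergence)
    show "integrable lborel (\<lambda>v. C * norm w * indicator (cball (0::'a) (1 + norm w)) v)"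
      by (intro integrable_mult_right integrable_real_indicator)
         (use emeasure_lborel_cball_finite[of "0::'a" "1 + norm w"] in auto)
    show "AE v in lborel. (\<lambda>n. q n v) \<longlonglongrightarrow> w \<bullet> g v"
      using deriv by eventually_elim (unfold q_def, rule GDERIV_difference_quotient)
    fix n
    have "norm (q n v) \<le> C * norm w * indicator (cball 0 (1 + norm w)) v" for v
    proof (cases "norm v \<le> 1 + norm w")
      case True
      have "\<bar>\<phi> (v + (1 / real (Suc n)) *\<^sub>R w) - \<phi> v\<bar> \<le> C * ((1 / real (Suc n)) * norm w)"
        using lipschitz_onD[OF lip, of "v + (1 / real (Suc n)) *\<^sub>R w" v] by (simp add: dist_norm)
      then have "real (Suc n) * \<bar>\<phi> (v + (1 / real (Suc n)) *\<^sub>R w) - \<phi> v\<bar> \<le> C * norm w"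
        by (simp add: field_simps)
      with True show ?thesis
        by (simp add: q_def abs_mult)
    next
      case False
      have "norm ((1 / real (Suc n)) *\<^sub>R w) \<le> norm w"
        by (simp add: divide_simps mult_le_cancel_left1)
      with False have "1 < norm (v + (1 / real (Suc n)) *\<^sub>R w)"
        using norm_diff_ineq[of v "(1 / real (Suc n)) *\<^sub>R w"] by linarith
      moreover have "1 < norm v"
        using False norm_ge_zero[of w] by linarith
      ultimately show ?thesis
        using False supp by (simp add: q_def)
    qed
    then show "AE v in lborel. norm (q n v) \<le> C * norm w * indicator (cball 0 (1 + norm w)) v"
      by simp
  qed (auto simp: q_def)
  then show ?thesis
    by (simp add: zero LIMSEQ_const_iff)
qed

lemma GDERIV_imp_continuous_on:
  assumes "\<And>v. GDERIV h v :> g v"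
  shows "continuous_on S h"
  using assms unfolding gderiv_def
  by (intro continuous_at_imp_continuous_on) (blast intro: has_derivative_continuous)

lemma continuous_bounded_on_unit_ball:
  fixes g :: "'a::euclidean_space \<Rightarrow> 'b::real_normed_vector"
  assumes "continuous_on UNIV g"
  obtains K where "0 \<le> K" "\<And>v. norm v \<le> 1 \<Longrightarrow> norm (g v) \<le> K"
proof -
  have "bounded (g ` cball 0 1)"
    by (intro compact_imp_bounded compact_continuous_image continuous_on_subset[OF assms]) auto
  then obtain K where K: "norm (g v) \<le> K" if "v \<in> cball 0 1" for v
    unfolding bounded_iff by blast
  moreover have "0 \<le> K"
    using order_trans[OF norm_ge_zero K[of 0]] by simp
  ultimately show thesis
    using that by simp
qed

lemma GDERIV_bound_imp_lipschitz:
  fixes h :: "'a::euclidean_space \<Rightarrow> real"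
  assumes "convex S" and "\<And>v. v \<in> S \<Longrightarrow> GDERIV h v :> g v"
    and bound: "\<And>v. v \<in> S \<Longrightarrow> norm (g v) \<le> K" and "0 \<le> K"
  shows "K-lipschitz_on S h"
proof (rule lipschitz_onI)
  fix a b assume ab: "a \<in> S" "b \<in> S"
  have "norm (h a - h b) \<le> K * norm (a - b)"
  proof (rule differentiable_bound[OF \<open>convex S\<close>])
    show "(h has_derivative (\<lambda>w. w \<bullet> g v)) (at v within S)" if "v \<in> S" for v
      using assms(2)[OF that] unfolding gderiv_def by (rule has_derivative_at_withinI)
    show "onorm (\<lambda>w. w \<bullet> g v) \<le> K" if "v \<in> S" for v
    proof (rule onorm_le)
      fix w show "norm (w \<bullet> g v) \<le> K * norm w"
        using Cauchy_Schwarz_ineq2[of w "g v"] mult_right_mono[OF bound[OF that] norm_ge_zero[of w]]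
        by (simp add: mult.commute)
    qed
  qed (use ab in auto)
  then show "dist (h a) (h b) \<le> K * dist a b"
    by (simp add: dist_norm)
qed fact

text \<open>The value is \<open>1\<close> on the ball of radius \<open>1 - \<epsilon>\<close>, \<open>0\<close> outside the unit ball and linear in \<open>norm v\<close> in
between. The gradient is therefore \<open>- (1/\<epsilon>) sgn v\<close> on the shell, an approximation of the surface
measure times the inner normal.\<close>

definition ball_cutoff :: "real \<Rightarrow> 'a::euclidean_space \<Rightarrow> real" where
  "ball_cutoff \<epsilon> v = min 1 (max 0 ((1 - norm v) / \<epsilon>))"

lemma abs_ball_cutoff_le_1: "\<bar>ball_cutoff \<epsilon> v\<bar> \<le> 1"
  by (simp add: ball_cutoff_def)

lemma ball_cutoff_outside: "0 < \<epsilon> \<Longrightarrow> 1 \<le> norm v \<Longrightarrow> ball_cutoff \<epsilon> v = 0"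
  by (simp add: ball_cutoff_def max_absorb1 divide_le_0_iff)

lemma ball_cutoff_inside: "0 < \<epsilon> \<Longrightarrow> norm v \<le> 1 - \<epsilon> \<Longrightarrow> ball_cutoff \<epsilon> v = 1"
  by (simp add: ball_cutoff_def min_def max_def field_simps)

lemma ball_cutoff_shell:
  "0 < \<epsilon> \<Longrightarrow> 1 - \<epsilon> \<le> norm v \<Longrightarrow> norm v \<le> 1 \<Longrightarrow> ball_cutoff \<epsilon> v = (1 - norm v) / \<epsilon>"
  by (simp add: ball_cutoff_def min_def max_def field_simps)

lemma ball_cutoff_measurable [measurable]: "ball_cutoff \<epsilon> \<in> borel_measurable borel"
  unfolding ball_cutoff_def[abs_def] by measurable

lemma ball_cutoff_lipschitz:
  assumes "0 < \<epsilon>"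
  shows "\<bar>ball_cutoff \<epsilon> a - ball_cutoff \<epsilon> b\<bar> \<le> norm (a - b) / \<epsilon>"
proof -
  have "\<bar>ball_cutoff \<epsilon> a - ball_cutoff \<epsilon> b\<bar> \<le> \<bar>(1 - norm a) / \<epsilon> - (1 - norm b) / \<epsilon>\<bar>"
    unfolding ball_cutoff_def by (simp add: min_def max_def abs_if)
  also have "\<dots> = \<bar>norm a - norm b\<bar> / \<epsilon>"
    using assms by (simp add: diff_divide_distrib[symmetric] abs_minus_commute)
  also have "\<dots> \<le> norm (a - b) / \<epsilon>"
    using assms by (intro divide_right_mono norm_triangle_ineq3) auto
  finally show ?thesis .
qed

lemma GDERIV_ball_cutoff:
  fixes v :: "'a::euclidean_space"
  assumes \<epsilon>: "0 < \<epsilon>" "\<epsilon> < 1" and v: "norm v \<noteq> 1 - \<epsilon>" "norm v \<noteq> 1"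
  shows "GDERIV (ball_cutoff \<epsilon>) v :>
    - (indicator {v. 1 - \<epsilon> < norm v \<and> norm v < 1} v / \<epsilon>) *\<^sub>R sgn v"
proof -
  have o1: "open {v::'a. norm v < 1 - \<epsilon>}" and o2: "open {v::'a. 1 < norm v}"
    and o3: "open {v::'a. 1 - \<epsilon> < norm v \<and> norm v < 1}"
    by (auto intro!: open_Collect_less open_Collect_conj continuous_intros)
  consider "norm v < 1 - \<epsilon>" | "1 < norm v" | "1 - \<epsilon> < norm v" "norm v < 1"
    using v by linarith
  then show ?thesis
  proof cases
    case 1
    have "GDERIV (ball_cutoff \<epsilon>) v :> 0"
      unfolding gderiv_def
      by (rule has_derivative_transform_within_open[OF GDERIV_const[of 1, unfolded gderiv_def] o1])
         (use 1 \<epsilon> in \<open>auto simp: ball_cutoff_inside\<close>)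
    with 1 show ?thesis by simp
  next
    case 2
    have "GDERIV (ball_cutoff \<epsilon>) v :> 0"
      unfolding gderiv_def
      by (rule has_derivative_transform_within_open[OF GDERIV_const[of 0, unfolded gderiv_def] o2])
         (use 2 \<epsilon> in \<open>auto simp: ball_cutoff_outside\<close>)
    with 2 show ?thesis by simp
  next
    case 3
    with \<epsilon> have "v \<noteq> 0" by auto
    have "DERIV (\<lambda>r. (1 - r) / \<epsilon>) (norm v) :> - 1 / \<epsilon>"
      using \<epsilon> by (auto intro!: derivative_eq_intros)
    from GDERIV_DERIV_compose[OF GDERIV_norm[OF \<open>v \<noteq> 0\<close>] this]
    have "GDERIV (\<lambda>v. (1 - norm v) / \<epsilon>) v :> (- 1 / \<epsilon>) *\<^sub>R sgn v" .
    then have "GDERIV (ball_cutoff \<epsilon>) v :> (- 1 / \<epsilon>) *\<^sub>R sgn v"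
      unfolding gderiv_def
      by (rule has_derivative_transform_within_open[OF _ o3])
         (use 3 \<epsilon> in \<open>auto simp: ball_cutoff_shell\<close>)
    with 3 show ?thesis by simp
  qed
qed

lemma integrable_unit_ball_bounded:
  fixes k :: "'a::euclidean_space \<Rightarrow> real"
  assumes [measurable]: "k \<in> borel_measurable borel"
    and bound: "\<And>v. norm v \<le> 1 \<Longrightarrow> \<bar>k v\<bar> \<le> C"
    and outside: "\<And>v. 1 < norm v \<Longrightarrow> k v = 0"
  shows "integrable lborel k"
proof (rule Bochner_Integration.integrable_bound)
  show "integrable lborel (\<lambda>v. C * indicator (cball (0::'a) 1) v)"
    by (intro integrable_mult_right integrable_real_indicator)
       (use emeasure_lborel_cball_finite[of "0::'a" 1] in auto)
  have "\<bar>k v\<bar> \<le> \<bar>C * indicator (cball 0 1) v\<bar>" for v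
    using bound[of v] outside[of v] by (cases "norm v \<le> 1") auto
  then show "AE v in lborel. norm (k v) \<le> norm (C * indicator (cball 0 1) v)"
    by simp
qed simp

text \<open>The function \<open>h v * ball_cutoff \<epsilon> v\<close> is Lipschitz with support in the unit ball, so its directional
derivative integrates to \<open>0\<close>; the product rule splits that derivative into the two integrands.\<close>

lemma integral_cutoff_by_parts:
  fixes h :: "'a::euclidean_space \<Rightarrow> real"
  assumes \<epsilon>: "0 < \<epsilon>" "\<epsilon> < 1"
    and h: "\<And>v. GDERIV h v :> g v" and g: "continuous_on UNIV g"
  shows "(\<integral>v. ball_cutoff \<epsilon> v * (w \<bullet> g v) \<partial>lborel)
    = (1 / \<epsilon>) * (\<integral>v. indicator {v. 1 - \<epsilon> < norm v \<and> norm v < 1} v * (h v * (w \<bullet> sgn v)) \<partial>lborel)"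
proof -
  let ?A = "{v::'a. 1 - \<epsilon> < norm v \<and> norm v < 1}"
  have h_cont: "continuous_on UNIV h"
    using h by (rule GDERIV_imp_continuous_on)
  have [measurable]: "g \<in> borel_measurable borel" "h \<in> borel_measurable borel"
    using g h_cont by (auto intro: borel_measurable_continuous_onI)
  obtain K where "0 \<le> K" and K: "\<And>v. norm v \<le> 1 \<Longrightarrow> norm (g v) \<le> K"
    using continuous_bounded_on_unit_ball[OF g] by blast
  obtain H where "0 \<le> H" and H: "\<And>v. norm v \<le> 1 \<Longrightarrow> \<bar>h v\<bar> \<le> H"
    using continuous_bounded_on_unit_ball[OF h_cont] by auto
  have h_lip: "K-lipschitz_on (cball 0 1) h"
    by (rule GDERIV_bound_imp_lipschitz[OF _ h]) (auto simp: K \<open>0 \<le> K\<close>)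
  let ?\<phi> = "\<lambda>v. h v * ball_cutoff \<epsilon> v"
  \<comment> \<open>The cutoff vanishes outside the ball, so a Lipschitz bound of \<open>h\<close> on the ball suffices.\<close>
  have one_inside: "\<bar>?\<phi> a - ?\<phi> b\<bar> \<le> (H / \<epsilon> + K) * norm (a - b)" if "norm a \<le> 1" for a b
  proof -
    have 1: "\<bar>h a\<bar> * \<bar>ball_cutoff \<epsilon> a - ball_cutoff \<epsilon> b\<bar> \<le> H * (norm (a - b) / \<epsilon>)"
      using H[OF that] \<open>0 \<le> H\<close> by (intro mult_mono ball_cutoff_lipschitz \<epsilon>) auto
    have 2: "\<bar>h a - h b\<bar> * \<bar>ball_cutoff \<epsilon> b\<bar> \<le> K * norm (a - b)"
    proof (cases "norm b \<le> 1")
      case True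
      have "\<bar>h a - h b\<bar> * \<bar>ball_cutoff \<epsilon> b\<bar> \<le> \<bar>h a - h b\<bar>"
        using abs_ball_cutoff_le_1[of \<epsilon> b] by (simp add: mult_left_le)
      also have "\<dots> \<le> K * norm (a - b)"
        using lipschitz_onD[OF h_lip, of a b] that True by (simp add: dist_norm)
      finally show ?thesis .
    next
      case False
      then show ?thesis
        using \<open>0 \<le> K\<close> \<epsilon> by (simp add: ball_cutoff_outside)
    qed
    have "?\<phi> a - ?\<phi> b = h a * (ball_cutoff \<epsilon> a - ball_cutoff \<epsilon> b) + (h a - h b) * ball_cutoff \<epsilon> b"
      by (simp add: algebra_simps)
    then have "\<bar>?\<phi> a - ?\<phi> b\<bar> \<le> \<bar>h a\<bar> * \<bar>ball_cutoff \<epsilon> a - ball_cutoff \<epsilon> b\<bar> + \<bar>h a - h b\<bar> * \<bar>ball_cutoff \<epsilon> b\<bar>"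
      using abs_triangle_ineq by (metis abs_mult)
    with 1 2 show ?thesis
      by (simp add: algebra_simps)
  qed
  have lip: "(H / \<epsilon> + K)-lipschitz_on UNIV ?\<phi>"
  proof (rule lipschitz_onI)
    fix a b :: 'a
    have "\<bar>?\<phi> a - ?\<phi> b\<bar> \<le> (H / \<epsilon> + K) * norm (a - b)"
    proof (cases "norm a \<le> 1 \<or> norm b \<le> 1")
      case True
      then show ?thesis
        using one_inside[of a b] one_inside[of b a] by (auto simp: abs_minus_commute norm_minus_commute)
    next
      case False
      then show ?thesis
        using \<open>0 \<le> H\<close> \<open>0 \<le> K\<close> \<epsilon> by (simp add: ball_cutoff_outside)
    qed
    then show "dist (?\<phi> a) (?\<phi> b) \<le> (H / \<epsilon> + K) * dist a b"
      by (simp add: dist_norm)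
  qed (use \<open>0 \<le> H\<close> \<open>0 \<le> K\<close> \<epsilon> in simp)
  let ?D = "\<lambda>v. h v *\<^sub>R (- (indicator ?A v / \<epsilon>) *\<^sub>R sgn v) + ball_cutoff \<epsilon> v *\<^sub>R g v"
  have "(\<integral>v. w \<bullet> ?D v \<partial>lborel) = 0"
  proof (rule integral_directional_derivative_eq_0[OF lip])
    show "AE v in lborel. GDERIV ?\<phi> v :> ?D v"
      using AE_norm_neq[of "1 - \<epsilon>"] AE_norm_neq[of 1]
    proof eventually_elim
      case (elim v)
      show ?case
        by (rule GDERIV_mult[OF h GDERIV_ball_cutoff[OF \<epsilon> elim]])
    qed
  qed (use \<epsilon> in \<open>auto simp: ball_cutoff_outside\<close>)
  moreover have "w \<bullet> ?D v = ball_cutoff \<epsilon> v * (w \<bullet> g v) - (1 / \<epsilon>) * (indicator ?A v * (h v * (w \<bullet> sgn v)))" for v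
    by (simp add: inner_add_right inner_diff_right)
  moreover have "integrable lborel (\<lambda>v. ball_cutoff \<epsilon> v * (w \<bullet> g v))"
  proof (rule integrable_unit_ball_bounded)
    fix v :: 'a assume "norm v \<le> 1"
    then show "\<bar>ball_cutoff \<epsilon> v * (w \<bullet> g v)\<bar> \<le> 1 * (norm w * K)"
      unfolding abs_mult
      using order_trans[OF Cauchy_Schwarz_ineq2 mult_left_mono[OF K norm_ge_zero], of v w]
      by (intro mult_mono abs_ball_cutoff_le_1) auto
  qed (use \<epsilon> in \<open>auto simp: ball_cutoff_outside\<close>)
  moreover have "integrable lborel (\<lambda>v. indicator ?A v * (h v * (w \<bullet> sgn v)))"
  proof (rule integrable_unit_ball_bounded)
    fix v :: 'a assume v: "norm v \<le> 1"
    have "\<bar>w \<bullet> sgn v\<bar> \<le> norm w"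
      using Cauchy_Schwarz_ineq2[of w "sgn v"] by (simp add: norm_sgn split: if_splits)
    then have "\<bar>h v * (w \<bullet> sgn v)\<bar> \<le> H * norm w"
      unfolding abs_mult using H[OF v] \<open>0 \<le> H\<close> by (intro mult_mono) auto
    then show "\<bar>indicator ?A v * (h v * (w \<bullet> sgn v))\<bar> \<le> H * norm w"
      using \<open>0 \<le> H\<close> by (simp add: indicator_def)
  qed auto
  ultimately show ?thesis
    by simp
qed

text \<open>The shell is, up to a null set, the difference of the balls of radius \<open>1\<close> and \<open>1 - \<epsilon>\<close>.\<close>

lemma integral_shell_angular:
  fixes k :: "'a::euclidean_space \<Rightarrow> real"
  assumes \<epsilon>: "0 < \<epsilon>" "\<epsilon> < 1" and [measurable]: "k \<in> borel_measurable borel"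
    and bound: "\<And>v. norm v \<le> 1 \<Longrightarrow> \<bar>k v\<bar> \<le> C"
  shows "(\<integral>v. indicator {v. 1 - \<epsilon> < norm v \<and> norm v < 1} v * k (sgn v) \<partial>lborel)
    = (1 - (1 - \<epsilon>) ^ DIM('a)) * (\<integral>v. indicator (ball 0 1) v * k (sgn v) \<partial>lborel)"
proof -
  have ks: "\<bar>k (sgn v)\<bar> \<le> C" for v
    by (rule bound) (simp add: norm_sgn)
  then have "0 \<le> C" using order_trans[OF abs_ge_zero] by blast
  have int: "integrable lborel (\<lambda>v. indicator (ball 0 r) v * k (sgn v))" if "r \<le> 1" for r
    by (rule integrable_unit_ball_bounded[where C = C])
       (use ks that \<open>0 \<le> C\<close> in \<open>auto simp: indicator_def\<close>)
  have "(\<integral>v. indicator {v. 1 - \<epsilon> < norm v \<and> norm v < 1} v * k (sgn v) \<partial>lborel)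
    = (\<integral>v. indicator (ball 0 1) v * k (sgn v) - indicator (ball 0 (1 - \<epsilon>)) v * k (sgn v) \<partial>lborel)"
  proof (rule integral_cong_AE)
    show "AE v in lborel. indicator {v. 1 - \<epsilon> < norm v \<and> norm v < 1} v * k (sgn v)
      = indicator (ball 0 1) v * k (sgn v) - indicator (ball 0 (1 - \<epsilon>)) v * k (sgn v)"
      using AE_norm_neq[of "1 - \<epsilon>"]
      by eventually_elim (use \<epsilon> in \<open>auto simp: indicator_def\<close>)
  qed measurable
  also have "\<dots> = (\<integral>v. indicator (ball 0 1) v * k (sgn v) \<partial>lborel)
      - (\<integral>v. indicator (ball 0 (1 - \<epsilon>)) v * k (sgn v) \<partial>lborel)"
    using \<epsilon> by (intro Bochner_Integration.integral_diff int) auto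
  also have "(\<integral>v. indicator (ball 0 (1 - \<epsilon>)) v * k (sgn v) \<partial>lborel)
      = (1 - \<epsilon>) ^ DIM('a) * (\<integral>v. indicator (ball 0 1) v * k (sgn v) \<partial>lborel)"
    using \<epsilon> by (intro integral_ball_angular) auto
  finally show ?thesis
    by (simp add: algebra_simps)
qed

text \<open>Divergence theorem for the field \<open>h w\<close> on the unit ball, with the surface integral written as an
integral of a function of \<open>sgn v\<close> over the ball; the factor \<open>DIM('a)\<close> is the ratio of the area of the
sphere to the volume of the ball. It is the limit of \<open>integral_cutoff_by_parts\<close> as \<open>\<epsilon>\<close> tends to \<open>0\<close>. On
the shell \<open>h v\<close> differs from \<open>h (sgn v)\<close> by \<open>O(\<epsilon>)\<close>, so that \<open>1/\<epsilon>\<close> times the shell integral is close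
to \<open>(1 - (1 - \<epsilon>) ^ DIM('a)) / \<epsilon>\<close> times the angular integral over the ball.\<close>

lemma divergence_unit_ball:
  fixes h :: "'a::euclidean_space \<Rightarrow> real"
  assumes h: "\<And>v. GDERIV h v :> g v" and g: "continuous_on UNIV g"
  shows "real DIM('a) * (\<integral>v. indicator (ball 0 1) v * (h (sgn v) * (w \<bullet> sgn v)) \<partial>lborel)
    = (\<integral>v. indicator (ball 0 1) v * (w \<bullet> g v) \<partial>lborel)"
proof -
  define \<epsilon> where "\<epsilon> n = 1 / real (Suc (Suc n))" for n
  have \<epsilon>: "0 < \<epsilon> n" "\<epsilon> n < 1" for n
    by (auto simp: \<epsilon>_def)
  have \<epsilon>_lim: "\<epsilon> \<longlonglongrightarrow> 0"
    using LIMSEQ_Suc[OF LIMSEQ_inverse_real_of_nat] by (simp add: \<epsilon>_def[abs_def] inverse_eq_divide)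
  have h_cont: "continuous_on UNIV h"
    using h by (rule GDERIV_imp_continuous_on)
  have [measurable]: "g \<in> borel_measurable borel" "h \<in> borel_measurable borel"
    using g h_cont by (auto intro: borel_measurable_continuous_onI)
  obtain K where "0 \<le> K" and K: "\<And>v. norm v \<le> 1 \<Longrightarrow> norm (g v) \<le> K"
    using continuous_bounded_on_unit_ball[OF g] by blast
  obtain H where "0 \<le> H" and H: "\<And>v. norm v \<le> 1 \<Longrightarrow> \<bar>h v\<bar> \<le> H"
    using continuous_bounded_on_unit_ball[OF h_cont] by auto
  have h_lip: "K-lipschitz_on (cball 0 1) h"
    by (rule GDERIV_bound_imp_lipschitz[OF _ h]) (auto simp: K \<open>0 \<le> K\<close>)
  have ws: "\<bar>w \<bullet> sgn v\<bar> \<le> norm w" for v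
    using Cauchy_Schwarz_ineq2[of w "sgn v"] by (simp add: norm_sgn split: if_splits)
  have wg: "\<bar>w \<bullet> g v\<bar> \<le> norm w * K" if "norm v \<le> 1" for v
    using order_trans[OF Cauchy_Schwarz_ineq2 mult_left_mono[OF K[OF that] norm_ge_zero], of w] .

  have volume: "(\<lambda>n. \<integral>v. ball_cutoff (\<epsilon> n) v * (w \<bullet> g v) \<partial>lborel)
      \<longlonglongrightarrow> (\<integral>v. indicator (ball 0 1) v * (w \<bullet> g v) \<partial>lborel)"
  proof (rule integral_dominated_convergence)
    show "integrable lborel (\<lambda>v. norm w * K * indicator (cball (0::'a) 1) v)"
      by (intro integrable_mult_right integrable_real_indicator)
         (use emeasure_lborel_cball_finite[of "0::'a" 1] in auto)
    have "(\<lambda>n. ball_cutoff (\<epsilon> n) v * (w \<bullet> g v)) \<longlonglongrightarrow> indicator (ball 0 1) v * (w \<bullet> g v)" for v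
    proof (cases "norm v < 1")
      case True
      then have "eventually (\<lambda>n. \<epsilon> n < 1 - norm v) sequentially"
        using order_tendstoD(2)[OF \<epsilon>_lim, of "1 - norm v"] by simp
      then have "eventually (\<lambda>n. ball_cutoff (\<epsilon> n) v * (w \<bullet> g v) = indicator (ball 0 1) v * (w \<bullet> g v)) sequentially"
        by eventually_elim (use True \<epsilon> in \<open>auto simp: ball_cutoff_inside\<close>)
      then show ?thesis
        by (rule tendsto_eventually)
    next
      case False
      then show ?thesis
        using \<epsilon> by (simp add: ball_cutoff_outside)
    qed
    then show "AE v in lborel. (\<lambda>n. ball_cutoff (\<epsilon> n) v * (w \<bullet> g v)) \<longlonglongrightarrow> indicator (ball 0 1) v * (w \<bullet> g v)"
      by simp
    fix n
    have "\<bar>ball_cutoff (\<epsilon> n) v * (w \<bullet> g v)\<bar> \<le> norm w * K * indicator (cball 0 1) v" for v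
    proof (cases "norm v \<le> 1")
      case True
      have "\<bar>ball_cutoff (\<epsilon> n) v * (w \<bullet> g v)\<bar> \<le> 1 * (norm w * K)"
        unfolding abs_mult by (intro mult_mono abs_ball_cutoff_le_1 wg True) auto
      with True show ?thesis by simp
    qed (use \<epsilon> \<open>0 \<le> K\<close> in \<open>simp add: ball_cutoff_outside\<close>)
    then show "AE v in lborel. norm (ball_cutoff (\<epsilon> n) v * (w \<bullet> g v)) \<le> norm w * K * indicator (cball 0 1) v"
      by simp
  qed auto

  define A where "A n = {v::'a. 1 - \<epsilon> n < norm v \<and> norm v < 1}" for n
  have [measurable]: "A n \<in> sets borel" for n
    by (simp add: A_def)
  define p where "p n = 1 - (1 - \<epsilon> n) ^ DIM('a)" for n
  define V where "V = (\<integral>v. indicator (ball (0::'a) 1) v * 1 \<partial>lborel :: real)"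
  define I where "I = (\<integral>v. indicator (ball 0 1) v * (h (sgn v) * (w \<bullet> sgn v)) \<partial>lborel)"
  define J where "J n = (1 / \<epsilon> n) * (\<integral>v. indicator (A n) v * (h v * (w \<bullet> sgn v)) \<partial>lborel)" for n
  have prod_bound: "\<bar>h a * (w \<bullet> sgn b)\<bar> \<le> H * norm w" if "norm a \<le> 1" for a b
    unfolding abs_mult using H[OF that] \<open>0 \<le> H\<close> by (intro mult_mono ws) auto
  \<comment> \<open>The projection \<open>sgn v\<close> of a point \<open>v\<close> of the shell is at distance at most \<open>\<epsilon> n\<close> from it.\<close>
  have close: "\<bar>J n - p n / \<epsilon> n * I\<bar> \<le> K * norm w * V * p n" for n
  proof -
    have int1: "integrable lborel (\<lambda>v. indicator (A n) v * (h v * (w \<bullet> sgn v)))"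
      by (rule integrable_unit_ball_bounded[where C = "H * norm w"])
         (use prod_bound \<open>0 \<le> H\<close> in \<open>auto simp: indicator_def A_def\<close>)
    have int2: "integrable lborel (\<lambda>v. indicator (A n) v * (h (sgn v) * (w \<bullet> sgn v)))"
      by (rule integrable_unit_ball_bounded[where C = "H * norm w"])
         (use prod_bound \<open>0 \<le> H\<close> in \<open>auto simp: indicator_def A_def norm_sgn\<close>)
    have int3: "integrable lborel (\<lambda>v. indicator (A n) v * 1 :: real)"
      by (rule integrable_unit_ball_bounded[where C = 1]) (auto simp: indicator_def A_def)
    have "(\<integral>v. indicator (A n) v * (h (sgn v) * (w \<bullet> sgn v)) \<partial>lborel) = p n * I"
      unfolding p_def I_def A_def
      by (subst integral_shell_angular[OF \<epsilon>, where k = "\<lambda>v. h v * (w \<bullet> v)" and C = "H * norm w"])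
         (auto simp: abs_mult intro!: mult_mono H \<open>0 \<le> H\<close>
           order_trans[OF Cauchy_Schwarz_ineq2] mult_left_le)
    then have "J n - p n / \<epsilon> n * I = (1 / \<epsilon> n) *
        (\<integral>v. indicator (A n) v * (h v * (w \<bullet> sgn v)) - indicator (A n) v * (h (sgn v) * (w \<bullet> sgn v)) \<partial>lborel)"
      using int1 int2 by (simp add: J_def algebra_simps)
    also have "\<bar>\<dots>\<bar> \<le> (1 / \<epsilon> n) * (\<integral>v. K * \<epsilon> n * norm w * (indicator (A n) v * 1) \<partial>lborel)"
      unfolding abs_mult abs_of_pos[OF divide_pos_pos[OF zero_less_one \<epsilon>(1)]]
    proof (intro mult_left_mono)
      have pw: "\<bar>indicator (A n) v * (h v * (w \<bullet> sgn v)) - indicator (A n) v * (h (sgn v) * (w \<bullet> sgn v))\<bar>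
          \<le> K * \<epsilon> n * norm w * (indicator (A n) v * 1)" for v
      proof (cases "v \<in> A n")
        case True
        then have v: "1 - \<epsilon> n < norm v" "norm v < 1" by (auto simp: A_def)
        then have "v \<noteq> 0" using \<epsilon>[of n] by auto
        have "v - sgn v = (1 - 1 / norm v) *\<^sub>R v"
          by (simp add: sgn_div_norm algebra_simps inverse_eq_divide)
        then have "norm (v - sgn v) = \<bar>norm v - 1\<bar>"
          using \<open>v \<noteq> 0\<close> abs_mult[of "1 - 1 / norm v" "norm v"] by (simp add: left_diff_distrib)
        then have *: "norm (v - sgn v) \<le> \<epsilon> n"
          using v by simp
        have "\<bar>h v - h (sgn v)\<bar> \<le> K * norm (v - sgn v)"
          using lipschitz_onD[OF h_lip, of v "sgn v"] v by (simp add: dist_norm norm_sgn)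
        also have "\<dots> \<le> K * \<epsilon> n"
          using * \<open>0 \<le> K\<close> by (rule mult_left_mono)
        finally have "\<bar>h v - h (sgn v)\<bar> * \<bar>w \<bullet> sgn v\<bar> \<le> K * \<epsilon> n * norm w"
          using \<open>0 \<le> K\<close> \<epsilon>(1)[of n] by (intro mult_mono ws) auto
        with True show ?thesis
          by (simp add: left_diff_distrib[symmetric] abs_mult)
      qed simp
      show "\<bar>\<integral>v. indicator (A n) v * (h v * (w \<bullet> sgn v)) - indicator (A n) v * (h (sgn v) * (w \<bullet> sgn v)) \<partial>lborel\<bar>
          \<le> (\<integral>v. K * \<epsilon> n * norm w * (indicator (A n) v * 1) \<partial>lborel)"
        by (rule order_trans[OF integral_abs_bound], rule integral_mono)
           (use pw int3 in \<open>auto intro!: Bochner_Integration.integrable_diff int1 int2\<close>)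
    qed (use \<epsilon>[of n] in simp)
    also have "\<dots> = K * norm w * (\<integral>v. indicator (A n) v * 1 \<partial>lborel)"
      using \<epsilon>(1)[of n] by (simp del: mult_1_right)
    also have "(\<integral>v. indicator (A n) v * 1 \<partial>lborel) = p n * V"
      unfolding p_def V_def A_def
      by (rule integral_shell_angular[OF \<epsilon>, where k = "\<lambda>_. 1" and C = 1]) auto
    finally show ?thesis
      by (simp add: mult_ac)
  qed
  have p_lim: "p \<longlonglongrightarrow> 0"
    unfolding p_def[abs_def] by (rule tendsto_eq_intros \<epsilon>_lim refl)+ simp
  have p_rate: "(\<lambda>n. p n / \<epsilon> n) \<longlonglongrightarrow> real DIM('a)"
  proof -
    have "DERIV (\<lambda>r. 1 - (1 - r) ^ DIM('a)) 0 :> real DIM('a)"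
      by (auto intro!: derivative_eq_intros)
    then have "((\<lambda>r. (1 - (1 - r) ^ DIM('a)) / r) \<longlongrightarrow> real DIM('a)) (at 0)"
      by (simp add: DERIV_def)
    moreover have "filterlim \<epsilon> (at 0) sequentially"
      unfolding filterlim_at using \<epsilon>_lim \<epsilon>(1) by (auto simp: less_imp_neq[symmetric])
    ultimately show ?thesis
      unfolding p_def by (rule filterlim_compose)
  qed
  have "(\<lambda>n. J n - p n / \<epsilon> n * I) \<longlonglongrightarrow> 0"
  proof (rule Lim_null_comparison)
    show "eventually (\<lambda>n. norm (J n - p n / \<epsilon> n * I) \<le> K * norm w * V * p n) sequentially"
      using close by simp
    show "(\<lambda>n. K * norm w * V * p n) \<longlonglongrightarrow> 0"
      using tendsto_mult_right_zero[OF p_lim] by simp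
  qed
  from tendsto_add[OF this tendsto_mult_right[OF p_rate, of I]]
  have lim: "J \<longlonglongrightarrow> real DIM('a) * I"
    by simp
  \<comment> \<open>The shell integrals are also the cutoff integrals, whose limit is already known.\<close>
  have J: "J n = (\<integral>v. ball_cutoff (\<epsilon> n) v * (w \<bullet> g v) \<partial>lborel)" for n
    unfolding J_def A_def by (rule integral_cutoff_by_parts[OF \<epsilon> h g, symmetric])
  have "J \<longlonglongrightarrow> (\<integral>v. indicator (ball 0 1) v * (w \<bullet> g v) \<partial>lborel)"
    using volume unfolding J[symmetric] .
  with lim show ?thesis
    unfolding I_def by (rule LIMSEQ_unique)
qed

section \<open>The uniform distributions on the unit sphere and the unit ball\<close>

abbreviation uniform_unit_ball :: "'a::euclidean_space measure" where
  "uniform_unit_ball \<equiv> uniform_measure lborel (ball 0 1)"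

lemma content_unit_ball_pos: "0 < measure lborel (ball (0::'a::euclidean_space) 1)"
  using content_ball_pos[of 1 "0::'a"] by simp

lemma emeasure_unit_ball:
  "emeasure lborel (ball (0::'a::euclidean_space) 1) = ennreal (measure lborel (ball (0::'a) 1))"
  using emeasure_lborel_ball_finite[of "0::'a" 1] by (simp add: emeasure_eq_ennreal_measure)

lemma prob_space_uniform_unit_ball: "prob_space (uniform_unit_ball :: 'a::euclidean_space measure)"
  using content_unit_ball_pos[where 'a = 'a]
  by (intro prob_space_uniform_measure) (auto simp: emeasure_unit_ball)

lemma integral_uniform_unit_ball:
  fixes k :: "'a::euclidean_space \<Rightarrow> real"
  assumes [measurable]: "k \<in> borel_measurable borel"
  shows "(\<integral>v. k v \<partial>uniform_unit_ball)
    = (\<integral>v. indicator (ball 0 1) v * k v \<partial>lborel) / measure lborel (ball (0::'a) 1)"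
proof -
  let ?V = "measure lborel (ball (0::'a) 1)"
  have "uniform_unit_ball = density lborel (\<lambda>v::'a. ennreal (indicator (ball 0 1) v / ?V))"
    unfolding uniform_measure_def emeasure_unit_ball
    using content_unit_ball_pos[where 'a = 'a]
    by (intro density_cong) (auto simp: ennreal_indicator[symmetric] divide_ennreal)
  then have "(\<integral>v. k v \<partial>uniform_unit_ball) = (\<integral>v. indicator (ball 0 1) v / ?V * k v \<partial>lborel)"
    by (simp add: integral_density)
  then show ?thesis
    by simp
qed

lemma integral_uniform_unit_sphere:
  fixes k :: "'a::euclidean_space \<Rightarrow> real"
  assumes [measurable]: "k \<in> borel_measurable borel"
  shows "(\<integral>u. k u \<partial>uniform_unit_sphere) = (\<integral>v. k (sgn v) \<partial>uniform_unit_ball)"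
  unfolding uniform_unit_sphere_def by (simp add: integral_distr)

lemma sets_uniform_unit_sphere [simp, measurable_cong]:
  "sets (uniform_unit_sphere :: 'a::euclidean_space measure) = sets borel"
  by (simp add: uniform_unit_sphere_def)

lemma space_uniform_unit_sphere [simp]:
  "space (uniform_unit_sphere :: 'a::euclidean_space measure) = UNIV"
  by (simp add: uniform_unit_sphere_def)

lemma AE_uniform_unit_ball: "AE v::'a::euclidean_space in uniform_unit_ball. norm v < 1"
  by (rule AE_uniform_measureI) auto

lemma AE_uniform_unit_sphere: "AE u::'a::euclidean_space in uniform_unit_sphere. norm u = 1"
proof -
  have "AE v::'a in uniform_unit_ball. v \<noteq> 0"
    using AE_norm_neq[of 0] by (intro AE_uniform_measureI) (auto elim: eventually_mono)
  then show ?thesis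
    unfolding uniform_unit_sphere_def
    by (subst AE_distr_iff) (auto simp: norm_sgn elim: eventually_mono)
qed

lemma integrable_uniform_unit_ball:
  fixes k :: "'a::euclidean_space \<Rightarrow> real"
  assumes "continuous_on UNIV k"
  shows "integrable uniform_unit_ball k"
proof -
  interpret prob_space "uniform_unit_ball :: 'a measure"
    by (rule prob_space_uniform_unit_ball)
  obtain K where "\<And>v. norm v \<le> 1 \<Longrightarrow> norm (k v) \<le> K"
    using continuous_bounded_on_unit_ball[OF assms] by blast
  then have "AE v in uniform_unit_ball. norm (k v) \<le> K"
    using AE_uniform_unit_ball by (auto elim: eventually_mono)
  moreover have "k \<in> borel_measurable uniform_unit_ball"
    using borel_measurable_continuous_onI[OF assms] by simp
  ultimately show ?thesis
    by (rule integrable_const_bound)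
qed

text \<open>Applied to constant and to linear \<open>h\<close> this gives the first two moments of the uniform direction, and
applied to a shifted objective it gives the mean of the residual estimate. It takes
the place of the rotation invariance of the sphere.\<close>

lemma divergence_uniform_unit_sphere:
  fixes h :: "'a::euclidean_space \<Rightarrow> real"
  assumes h: "\<And>v. GDERIV h v :> g v" and g: "continuous_on UNIV g"
  shows "real DIM('a) * (\<integral>u. h u * (w \<bullet> u) \<partial>uniform_unit_sphere)
    = (\<integral>v. w \<bullet> g v \<partial>uniform_unit_ball)"
proof -
  have [measurable]: "g \<in> borel_measurable borel" "h \<in> borel_measurable borel"
    using g GDERIV_imp_continuous_on[OF h] by (auto intro: borel_measurable_continuous_onI)
  show ?thesis
    using divergence_unit_ball[OF h g, of w]
    by (simp add: integral_uniform_unit_sphere integral_uniform_unit_ball)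
qed

lemma integral_inner_uniform_unit_sphere:
  fixes w :: "'a::euclidean_space"
  shows "(\<integral>u. w \<bullet> u \<partial>uniform_unit_sphere) = 0"
  using divergence_uniform_unit_sphere[of "\<lambda>_. 1" "\<lambda>_. 0" w] by (simp add: GDERIV_const)

lemma integral_inner_sq_uniform_unit_sphere:
  fixes w :: "'a::euclidean_space"
  shows "(\<integral>u. (w \<bullet> u)\<^sup>2 \<partial>uniform_unit_sphere) = (norm w)\<^sup>2 / real DIM('a)"
proof -
  interpret prob_space "uniform_unit_ball :: 'a measure"
    by (rule prob_space_uniform_unit_ball)
  have "GDERIV (\<lambda>u. w \<bullet> u) v :> w" for v
    unfolding gderiv_def by (auto intro!: derivative_eq_intros simp: inner_commute)
  from divergence_uniform_unit_sphere[OF this, of w]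
  have "real DIM('a) * (\<integral>u. (w \<bullet> u)\<^sup>2 \<partial>uniform_unit_sphere) = (norm w)\<^sup>2"
    by (simp add: power2_eq_square[symmetric] power2_norm_eq_inner prob_space[simplified])
  then show ?thesis
    by (simp add: field_simps)
qed

lemma integral_inner_uniform_unit_ball:
  fixes w :: "'a::euclidean_space"
  shows "(\<integral>v. v \<bullet> w \<partial>uniform_unit_ball) = 0"
proof -
  have "indicator (ball 0 1) (- v) = (indicator (ball 0 1) v :: real)" for v :: 'a
    by (simp add: indicator_def)
  then have "(\<integral>v. indicator (ball 0 1) v * (v \<bullet> w) \<partial>lborel) = 0"
    using lborel_integral_affine[of "-1" "\<lambda>v. indicator (ball 0 1) v * (v \<bullet> w)" 0] by simp
  then show ?thesis
    by (simp add: integral_uniform_unit_ball)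
qed

text \<open>By convexity the difference quotients of \<open>f\<close> towards \<open>z\<close> stay below \<open>f z - f y\<close>, hence so does their
limit.\<close>

lemma convex_on_above_gradient:
  fixes f :: "'a::euclidean_space \<Rightarrow> real"
  assumes f: "convex_on UNIV f" and g: "GDERIV f y :> g"
  shows "f y + (z - y) \<bullet> g \<le> f z"
proof -
  have "real (Suc n) * (f (y + (1 / real (Suc n)) *\<^sub>R (z - y)) - f y) \<le> f z - f y" for n
  proof -
    let ?t = "1 / real (Suc n)"
    have "y + ?t *\<^sub>R (z - y) = (1 - ?t) *\<^sub>R y + ?t *\<^sub>R z"
      by (simp add: algebra_simps)
    then have "f (y + ?t *\<^sub>R (z - y)) \<le> (1 - ?t) * f y + ?t * f z"
      using convex_onD[OF f, of ?t y z] by simp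
    then have "f (y + ?t *\<^sub>R (z - y)) - f y \<le> ?t * (f z - f y)"
      by (simp add: algebra_simps diff_divide_distrib)
    from mult_left_mono[OF this, of "real (Suc n)"] show ?thesis
      by simp
  qed
  with GDERIV_difference_quotient[OF g, of "z - y"] have "(z - y) \<bullet> g \<le> f z - f y"
    by (intro LIMSEQ_le_const2) auto
  then show ?thesis
    by simp
qed

text \<open>The mean of the gradient estimate is the mean of \<open>grad f (x + \<alpha> v)\<close> over the ball. Convexity is used
between the points \<open>x + \<alpha> v\<close> and \<open>y + \<alpha> v\<close>, shifted by the same \<open>\<alpha> v\<close>, so that their difference is
exactly \<open>x - y\<close>. The shift is removed afterwards: at \<open>x\<close> by Jensen's inequality and at \<open>y\<close> by the
quadratic upper bound.\<close>

lemma sphere_smoothing_descent: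
  fixes f :: "'a::euclidean_space \<Rightarrow> real"
  assumes convex: "convex_on UNIV f"
    and g: "\<And>y. GDERIV f y :> g y" "continuous_on UNIV g"
    and upper: "\<And>h. f (y + h) \<le> f y + L / 2 * (norm h)\<^sup>2"
    and "0 < \<alpha>" "0 \<le> L"
  shows "f x - f y - L * \<alpha>\<^sup>2 / 2
    \<le> real DIM('a) / \<alpha> * (\<integral>u. f (x + \<alpha> *\<^sub>R u) * ((x - y) \<bullet> u) \<partial>uniform_unit_sphere)"
proof -
  interpret prob_space "uniform_unit_ball :: 'a measure"
    by (rule prob_space_uniform_unit_ball)
  have f_cont: "continuous_on UNIV f"
    using g(1) by (rule GDERIV_imp_continuous_on)
  have f_comp: "continuous_on UNIV (\<lambda>v. f (z + \<alpha> *\<^sub>R v))" for z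
    by (rule continuous_on_compose2[OF f_cont]) (auto intro!: continuous_intros)
  have g_comp: "continuous_on UNIV (\<lambda>v. g (z + \<alpha> *\<^sub>R v))" for z
    by (rule continuous_on_compose2[OF g(2)]) (auto intro!: continuous_intros)
  have "GDERIV (\<lambda>v. f (x + \<alpha> *\<^sub>R v)) v :> \<alpha> *\<^sub>R g (x + \<alpha> *\<^sub>R v)" for v
  proof -
    have "((\<lambda>v. x + \<alpha> *\<^sub>R v) has_derivative (\<lambda>h. \<alpha> *\<^sub>R h)) (at v)"
      by (auto intro!: derivative_eq_intros)
    from has_derivative_compose[OF this g(1)[unfolded gderiv_def]] show ?thesis
      by (simp add: gderiv_def)
  qed
  from divergence_uniform_unit_sphere[OF this, of "x - y"]
  have "real DIM('a) / \<alpha> * (\<integral>u. f (x + \<alpha> *\<^sub>R u) * ((x - y) \<bullet> u) \<partial>uniform_unit_sphere)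
    = (\<integral>v. (x - y) \<bullet> g (x + \<alpha> *\<^sub>R v) \<partial>uniform_unit_ball)"
    using \<open>0 < \<alpha>\<close> g_comp by (simp add: continuous_on_scaleR field_simps)
  moreover have "f x - (f y + L * \<alpha>\<^sup>2 / 2) \<le> (\<integral>v. (x - y) \<bullet> g (x + \<alpha> *\<^sub>R v) \<partial>uniform_unit_ball)"
  proof -
    have "f x = (\<integral>v. f x + \<alpha> * (v \<bullet> g x) \<partial>uniform_unit_ball)"
      by (subst Bochner_Integration.integral_add)
         (auto intro!: integrable_uniform_unit_ball continuous_intros
           simp: integral_inner_uniform_unit_ball prob_space[simplified])
    also have "\<dots> \<le> (\<integral>v. f (x + \<alpha> *\<^sub>R v) \<partial>uniform_unit_ball)"
    proof (rule integral_mono)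
      show "f x + \<alpha> * (v \<bullet> g x) \<le> f (x + \<alpha> *\<^sub>R v)" for v
        using convex_on_above_gradient[OF convex g(1), of x "x + \<alpha> *\<^sub>R v"] by simp
    qed (auto intro!: integrable_uniform_unit_ball f_comp continuous_intros)
    finally have 1: "f x \<le> (\<integral>v. f (x + \<alpha> *\<^sub>R v) \<partial>uniform_unit_ball)" .
    have "(\<integral>v. f (y + \<alpha> *\<^sub>R v) \<partial>uniform_unit_ball) \<le> (\<integral>v. f y + L * \<alpha>\<^sup>2 / 2 \<partial>(uniform_unit_ball :: 'a measure))"
    proof (rule integral_mono_AE)
      show "AE v in uniform_unit_ball. f (y + \<alpha> *\<^sub>R v) \<le> f y + L * \<alpha>\<^sup>2 / 2"
        using AE_uniform_unit_ball
      proof eventually_elim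
        case (elim v)
        have "(norm (\<alpha> *\<^sub>R v))\<^sup>2 \<le> \<alpha>\<^sup>2"
          using elim \<open>0 < \<alpha>\<close> by (simp add: power_mult_distrib power_le_one mult_left_le)
        from mult_left_mono[OF this, of "L / 2"] show ?case
          using upper[of "\<alpha> *\<^sub>R v"] \<open>0 \<le> L\<close> by simp
      qed
    qed (auto intro!: integrable_uniform_unit_ball f_comp)
    then have 2: "(\<integral>v. f (y + \<alpha> *\<^sub>R v) \<partial>uniform_unit_ball) \<le> f y + L * \<alpha>\<^sup>2 / 2"
      by (simp add: prob_space[simplified])
    have "(\<integral>v. f (x + \<alpha> *\<^sub>R v) - f (y + \<alpha> *\<^sub>R v) \<partial>uniform_unit_ball)
      \<le> (\<integral>v. (x - y) \<bullet> g (x + \<alpha> *\<^sub>R v) \<partial>uniform_unit_ball)"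
    proof (rule integral_mono)
      show "f (x + \<alpha> *\<^sub>R v) - f (y + \<alpha> *\<^sub>R v) \<le> (x - y) \<bullet> g (x + \<alpha> *\<^sub>R v)" for v
        using convex_on_above_gradient[OF convex g(1), of "x + \<alpha> *\<^sub>R v" "y + \<alpha> *\<^sub>R v"]
        by (simp add: inner_diff_left)
    qed (auto intro!: integrable_uniform_unit_ball f_comp g_comp continuous_intros)
    then have "(\<integral>v. f (x + \<alpha> *\<^sub>R v) \<partial>uniform_unit_ball) - (\<integral>v. f (y + \<alpha> *\<^sub>R v) \<partial>uniform_unit_ball)
      \<le> (\<integral>v. (x - y) \<bullet> g (x + \<alpha> *\<^sub>R v) \<partial>uniform_unit_ball)"
      by (subst (asm) Bochner_Integration.integral_diff)
         (auto intro!: integrable_uniform_unit_ball f_comp)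
    with 1 2 show ?thesis by linarith
  qed
  ultimately show ?thesis
    by simp
qed

section \<open>Convex objectives given as expectations of smooth functions\<close>

text \<open>Replacing \<open>y\<close> by simple functions converging to it gives countably many sections, each of them
measurable; continuity identifies the limit.\<close>

lemma borel_measurable_caratheodory:
  fixes F :: "'a::{second_countable_topology, metric_space} \<Rightarrow> 's \<Rightarrow> 'b::metric_space"
  assumes meas: "\<And>y. F y \<in> borel_measurable D"
    and cont: "\<And>s. s \<in> space D \<Longrightarrow> continuous_on UNIV (\<lambda>y. F y s)"
  shows "(\<lambda>p. F (fst p) (snd p)) \<in> borel_measurable (borel \<Otimes>\<^sub>M D)"
proof -
  obtain S :: "nat \<Rightarrow> 'a \<Rightarrow> 'a" where S: "\<And>i. simple_function borel (S i)"
    and S_lim: "\<And>y. (\<lambda>i. S i y) \<longlonglongrightarrow> y"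
    using borel_measurable_implies_sequence_metric[OF measurable_ident_sets[OF refl], where ?'b = 'a]
    by (metis id_apply space_borel UNIV_I)
  show ?thesis
  proof (rule borel_measurable_LIMSEQ_metric)
    fix i
    show "(\<lambda>p. F (S i (fst p)) (snd p)) \<in> borel_measurable (borel \<Otimes>\<^sub>M D)"
    proof (rule measurable_compose_countable'[where f = "\<lambda>y p. F y (snd p)" and I = "range (S i)"])
      have "S i \<in> measurable borel (count_space (range (S i)))"
        by (subst measurable_count_space_eq_countable)
           (use S[of i] in \<open>auto simp: simple_function_def intro: countable_finite\<close>)
      then show "(\<lambda>p. S i (fst p)) \<in> measurable (borel \<Otimes>\<^sub>M D) (count_space (range (S i)))"
        by (rule measurable_compose[OF measurable_fst])
      show "countable (range (S i))"
        using S[of i] by (auto simp: simple_function_def intro: countable_finite)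
    qed (use meas in \<open>auto intro: measurable_compose[OF measurable_snd]\<close>)
  next
    fix p :: "'a \<times> 's" assume "p \<in> space (borel \<Otimes>\<^sub>M D)"
    then have "continuous_on UNIV (\<lambda>y. F y (snd p))"
      by (intro cont) (auto simp: space_pair_measure)
    then have "isCont (\<lambda>y. F y (snd p)) (fst p)"
      by (simp add: continuous_on_eq_continuous_at)
    then show "(\<lambda>i. F (S i (fst p)) (snd p)) \<longlonglongrightarrow> F (fst p) (snd p)"
      by (rule isCont_tendsto_compose) (rule S_lim)
  qed
qed

text \<open>Along the segment from \<open>y\<close> to \<open>y + h\<close> the remainder has a derivative of size at most
\<open>L t (norm h)\<^sup>2\<close>, and both the remainder and its negative can be compared with \<open>L t\<^sup>2 / 2 (norm h)\<^sup>2\<close>.\<close>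

lemma smooth_with_quadratic_remainder:
  fixes \<phi> :: "'a::euclidean_space \<Rightarrow> real"
  assumes "smooth_with L \<phi>"
  shows "\<bar>\<phi> (y + h) - \<phi> y - h \<bullet> gradient \<phi> y\<bar> \<le> L / 2 * (norm h)\<^sup>2"
proof -
  have G: "GDERIV \<phi> z :> gradient \<phi> z" for z
    using assms by (auto simp: smooth_with_def intro: GDERIV_gradient)
  have lip: "norm (gradient \<phi> a - gradient \<phi> b) \<le> L * norm (a - b)" for a b
    using assms by (auto simp: smooth_with_def)
  define r where "r t = \<phi> (y + t *\<^sub>R h) - \<phi> y - t * (h \<bullet> gradient \<phi> y)" for t
  have r: "DERIV r t :> h \<bullet> (gradient \<phi> (y + t *\<^sub>R h) - gradient \<phi> y)" for t
  proof -
    have "((\<lambda>t. y + t *\<^sub>R h) has_derivative (\<lambda>t. t *\<^sub>R h)) (at t)"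
      by (auto intro!: derivative_eq_intros)
    from has_derivative_compose[OF this G[unfolded gderiv_def]]
    have "DERIV (\<lambda>t. \<phi> (y + t *\<^sub>R h)) t :> h \<bullet> gradient \<phi> (y + t *\<^sub>R h)"
      by (simp add: has_field_derivative_def mult_commute_abs)
    then show ?thesis
      unfolding r_def[abs_def] by (auto intro!: derivative_eq_intros simp: inner_diff_right)
  qed
  have bound: "\<bar>h \<bullet> (gradient \<phi> (y + t *\<^sub>R h) - gradient \<phi> y)\<bar> \<le> L * t * (norm h)\<^sup>2" if "0 \<le> t" for t
  proof -
    have "\<bar>h \<bullet> (gradient \<phi> (y + t *\<^sub>R h) - gradient \<phi> y)\<bar>
        \<le> norm h * norm (gradient \<phi> (y + t *\<^sub>R h) - gradient \<phi> y)"
      by (rule Cauchy_Schwarz_ineq2)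
    also have "\<dots> \<le> norm h * (L * norm (t *\<^sub>R h))"
      using lip[of "y + t *\<^sub>R h" y] by (intro mult_left_mono) auto
    finally show ?thesis
      using that by (simp add: power2_eq_square mult_ac)
  qed
  have "r 0 = 0"
    by (simp add: r_def)
  \<comment> \<open>\<open>c = 1\<close> and \<open>c = -1\<close> give the upper and the lower bound of the remainder.\<close>
  have "c * r 1 - L * 1\<^sup>2 / 2 * (norm h)\<^sup>2 \<le> c * r 0 - L * 0\<^sup>2 / 2 * (norm h)\<^sup>2" if "\<bar>c\<bar> = 1" for c
  proof (rule DERIV_nonpos_imp_nonincreasing[where f = "\<lambda>t. c * r t - L * t\<^sup>2 / 2 * (norm h)\<^sup>2"])
    fix t :: real assume "0 \<le> t"
    let ?d = "c * (h \<bullet> (gradient \<phi> (y + t *\<^sub>R h) - gradient \<phi> y)) - L * t * (norm h)\<^sup>2"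
    have "DERIV (\<lambda>t. c * r t - L * t\<^sup>2 / 2 * (norm h)\<^sup>2) t :> ?d"
      by (auto intro!: derivative_eq_intros r simp: power2_eq_square)
    moreover have "c * (h \<bullet> (gradient \<phi> (y + t *\<^sub>R h) - gradient \<phi> y))
        \<le> \<bar>h \<bullet> (gradient \<phi> (y + t *\<^sub>R h) - gradient \<phi> y)\<bar>"
      using abs_ge_self[of "c * (h \<bullet> (gradient \<phi> (y + t *\<^sub>R h) - gradient \<phi> y))"] that
      by (simp add: abs_mult)
    ultimately show "\<exists>d. DERIV (\<lambda>t. c * r t - L * t\<^sup>2 / 2 * (norm h)\<^sup>2) t :> d \<and> d \<le> 0"
      using bound[OF \<open>0 \<le> t\<close>] by (intro exI[of _ ?d]) simp
  qed simp
  from this[of 1] this[of "-1"] \<open>r 0 = 0\<close>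
  have "r 1 \<le> L / 2 * (norm h)\<^sup>2" "- r 1 \<le> L / 2 * (norm h)\<^sup>2"
    by simp_all
  then have "\<bar>r 1\<bar> \<le> L / 2 * (norm h)\<^sup>2"
    by (rule abs_leI)
  then show ?thesis
    by (simp add: r_def)
qed

lemma GDERIV_quadratic_remainder:
  fixes \<phi> :: "'a::euclidean_space \<Rightarrow> real"
  assumes "\<And>h. \<bar>\<phi> (y + h) - \<phi> y - h \<bullet> g\<bar> \<le> C * (norm h)\<^sup>2"
  shows "GDERIV \<phi> y :> g"
  unfolding gderiv_def has_derivative_at
proof
  show "bounded_linear (\<lambda>h. h \<bullet> g)"
    by (rule bounded_linear_inner_left)
  show "(\<lambda>h. norm (\<phi> (y + h) - \<phi> y - h \<bullet> g) / norm h) \<midarrow>0\<rightarrow> 0"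
  proof (rule Lim_null_comparison)
    show "eventually (\<lambda>h. norm (norm (\<phi> (y + h) - \<phi> y - h \<bullet> g) / norm h) \<le> C * norm h) (at 0)"
    proof (rule eventually_at_filter[THEN iffD2], intro always_eventually allI impI)
      fix h :: 'a assume "h \<noteq> 0"
      then show "norm (norm (\<phi> (y + h) - \<phi> y - h \<bullet> g) / norm h) \<le> C * norm h"
        using assms[of h] by (simp add: divide_simps power2_eq_square mult.assoc)
    qed
    show "(\<lambda>h. C * norm h) \<midarrow>0\<rightarrow> 0"
      by (auto intro!: tendsto_eq_intros)
  qed
qed

lemma (in prob_space) integrable_if_square_integrable:
  fixes X :: "'a \<Rightarrow> 'b::{banach, second_countable_topology}"
  assumes "X \<in> borel_measurable M" "integrable M (\<lambda>\<omega>. (norm (X \<omega>))\<^sup>2)"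
  shows "integrable M X"
proof (rule Bochner_Integration.integrable_bound)
  show "integrable M (\<lambda>\<omega>. 1 + (norm (X \<omega>))\<^sup>2)"
    using assms by simp
  have "norm a \<le> 1 + (norm a)\<^sup>2" for a :: 'b
    using zero_le_power2[of "norm a - 1/2"] by (simp add: power2_eq_square algebra_simps)
  then show "AE \<omega> in M. norm (X \<omega>) \<le> norm (1 + (norm (X \<omega>))\<^sup>2)"
    by simp
qed fact

text \<open>The gradient of the mean \<open>f\<close> that occurs in the variance bound exists as a consequence of the
smoothness of the samples (\<open>GDERIV_f\<close>).\<close>

locale stochastic_objective = prob_space D
  for D :: "'s measure" +
  fixes F :: "'a::euclidean_space \<Rightarrow> 's \<Rightarrow> real"
    and f :: "'a \<Rightarrow> real"
    and L0 L \<sigma>0 \<sigma>1 :: real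
    and xstar :: 'a
  assumes integrable_F: "integrable D (F y)"
    and f_eq: "f y = (\<integral>s. F y s \<partial>D)"
    and L_pos: "0 < L"
    and f_convex: "convex_on UNIV f"
    and f_lipschitz: "L0-lipschitz_on UNIV f"
    and minimizer: "f xstar \<le> f y"
    and F_smooth: "s \<in> space D \<Longrightarrow> smooth_with L (\<lambda>y. F y s)"
    and integrable_value_sq: "integrable D (\<lambda>s. (F y s - f y)\<^sup>2)"
    and value_variance: "(\<integral>s. (F y s - f y)\<^sup>2 \<partial>D) \<le> \<sigma>0\<^sup>2"
    and integrable_gradient_sq:
      "integrable D (\<lambda>s. (norm (gradient (\<lambda>z. F z s) y - gradient f y))\<^sup>2)"
    and gradient_variance:
      "(\<integral>s. (norm (gradient (\<lambda>z. F z s) y - gradient f y))\<^sup>2 \<partial>D) \<le> \<sigma>1\<^sup>2"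
begin

abbreviation gradF :: "'a \<Rightarrow> 's \<Rightarrow> 'a" where
  "gradF y s \<equiv> gradient (\<lambda>z. F z s) y"

abbreviation gradf :: "'a \<Rightarrow> 'a" where
  "gradf \<equiv> gradient f"

lemma GDERIV_F: "s \<in> space D \<Longrightarrow> GDERIV (\<lambda>y. F y s) y :> gradF y s"
  using F_smooth by (auto simp: smooth_with_def intro: GDERIV_gradient)

lemma measurable_F_pair: "(\<lambda>p. F (fst p) (snd p)) \<in> borel_measurable (borel \<Otimes>\<^sub>M D)"
proof (rule borel_measurable_caratheodory)
  show "F y \<in> borel_measurable D" for y
    using integrable_F by simp
  show "continuous_on UNIV (\<lambda>y. F y s)" if "s \<in> space D" for s
    using GDERIV_F[OF that] by (rule GDERIV_imp_continuous_on)
qed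

lemma measurable_F [measurable (raw)]:
  assumes "Y \<in> borel_measurable N" "X \<in> measurable N D"
  shows "(\<lambda>\<omega>. F (Y \<omega>) (X \<omega>)) \<in> borel_measurable N"
  using measurable_compose[OF measurable_Pair[OF assms] measurable_F_pair] by simp

text \<open>Each component of the gradient is a limit of difference quotients of \<open>F\<close>.\<close>

lemma measurable_gradF [measurable (raw)]:
  assumes [measurable]: "Y \<in> borel_measurable N" "X \<in> measurable N D"
  shows "(\<lambda>\<omega>. gradF (Y \<omega>) (X \<omega>)) \<in> borel_measurable N"
proof (subst borel_measurable_euclidean_space, intro ballI)
  fix b :: 'a
  show "(\<lambda>\<omega>. gradF (Y \<omega>) (X \<omega>) \<bullet> b) \<in> borel_measurable N"
  proof (rule borel_measurable_LIMSEQ_real)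
    fix \<omega> assume "\<omega> \<in> space N"
    then have "X \<omega> \<in> space D"
      by (rule measurable_space[OF assms(2)])
    from GDERIV_difference_quotient[OF GDERIV_F[OF this], of "Y \<omega>" b]
    show "(\<lambda>n. real (Suc n) * (F (Y \<omega> + (1 / real (Suc n)) *\<^sub>R b) (X \<omega>) - F (Y \<omega>) (X \<omega>)))
        \<longlonglongrightarrow> gradF (Y \<omega>) (X \<omega>) \<bullet> b"
      by (simp only: inner_commute)
  qed measurable
qed

lemma measurable_f [measurable]: "f \<in> borel_measurable borel"
  using lipschitz_on_continuous_on[OF f_lipschitz] by (rule borel_measurable_continuous_onI)

lemma integrable_gradF: "integrable D (gradF y)"
proof -
  have "integrable D (\<lambda>s. gradF y s - gradf y)"
    by (rule integrable_if_square_integrable) (use integrable_gradient_sq in auto)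
  from Bochner_Integration.integrable_add[OF this integrable_const[of "gradf y"]] show ?thesis
    by simp
qed

text \<open>Differentiation under the integral sign. The quadratic remainder of the samples is uniform in \<open>s\<close>, so
it survives integration and determines the derivative of \<open>f\<close>.\<close>

lemma GDERIV_f: "GDERIV f y :> (\<integral>s. gradF y s \<partial>D)"
proof (rule GDERIV_quadratic_remainder)
  fix h
  have "f (y + h) - f y - h \<bullet> (\<integral>s. gradF y s \<partial>D)
      = (\<integral>s. F (y + h) s - F y s - h \<bullet> gradF y s \<partial>D)"
    unfolding f_eq using integrable_F integrable_gradF by simp
  also have "\<bar>\<dots>\<bar> \<le> (\<integral>s. L / 2 * (norm h)\<^sup>2 \<partial>D)"
    by (rule order_trans[OF integral_abs_bound], rule integral_mono)
       (use integrable_F integrable_gradF smooth_with_quadratic_remainder[OF F_smooth] in auto)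
  finally show "\<bar>f (y + h) - f y - h \<bullet> (\<integral>s. gradF y s \<partial>D)\<bar> \<le> L / 2 * (norm h)\<^sup>2"
    by (simp add: prob_space)
qed

lemma gradf_eq: "gradf y = (\<integral>s. gradF y s \<partial>D)"
  by (rule gradient_eqI) (rule GDERIV_f)

lemma GDERIV_gradf: "GDERIV f y :> gradf y"
  unfolding gradf_eq by (rule GDERIV_f)

lemma f_smooth: "smooth_with L f"
  unfolding smooth_with_def
proof (intro conjI allI)
  show "f differentiable at y" for y
    using GDERIV_gradf unfolding gderiv_def by (rule differentiableI)
  fix y z
  have "norm (gradf y - gradf z) = norm (\<integral>s. gradF y s - gradF z s \<partial>D)"
    unfolding gradf_eq using integrable_gradF by simp
  also have "\<dots> \<le> (\<integral>s. L * norm (y - z) \<partial>D)"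
    by (rule order_trans[OF integral_norm_bound], rule integral_mono)
       (use integrable_gradF F_smooth in \<open>auto simp: smooth_with_def\<close>)
  finally show "norm (gradf y - gradf z) \<le> L * norm (y - z)"
    by (simp add: prob_space)
qed

lemma gradf_continuous: "continuous_on UNIV gradf"
proof (rule lipschitz_on_continuous_on)
  show "L-lipschitz_on UNIV gradf"
    using f_smooth L_pos by (auto simp: smooth_with_def dist_norm intro!: lipschitz_onI)
qed

lemma measurable_gradf [measurable]: "gradf \<in> borel_measurable borel"
  using gradf_continuous by (rule borel_measurable_continuous_onI)

lemma norm_gradf_le: "norm (gradf y) \<le> L0"
proof -
  let ?g = "gradf y"
  have "real (Suc n) * (f (y + (1 / real (Suc n)) *\<^sub>R ?g) - f y) \<le> L0 * norm ?g" for n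
    using lipschitz_onD[OF f_lipschitz, of "y + (1 / real (Suc n)) *\<^sub>R ?g" y]
    by (simp add: dist_norm field_simps abs_le_iff)
  with GDERIV_difference_quotient[OF GDERIV_gradf, of y ?g] have "?g \<bullet> ?g \<le> L0 * norm ?g"
    by (intro LIMSEQ_le_const2) auto
  then have "norm ?g * norm ?g \<le> L0 * norm ?g"
    by (simp add: power2_norm_eq_inner[symmetric] power2_eq_square)
  then show ?thesis
    using lipschitz_on_nonneg[OF f_lipschitz] by (cases "?g = 0") auto
qed

text \<open>A gradient step of length \<open>1 / L\<close> decreases \<open>f\<close> by at least \<open>(norm (gradf y))\<^sup>2 / (2 L)\<close>, and cannot get
below the minimum. This is what turns the gradient terms in the variance into the gap itself.\<close>

lemma norm_gradf_sq_le_gap: "(norm (gradf y))\<^sup>2 \<le> 2 * L * (f y - f xstar)"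
proof -
  let ?h = "- (1 / L) *\<^sub>R gradf y"
  have "f (y + ?h) - f y - ?h \<bullet> gradf y \<le> L / 2 * (norm ?h)\<^sup>2"
    using smooth_with_quadratic_remainder[OF f_smooth, of y ?h] by (rule abs_le_D1)
  moreover have "?h \<bullet> gradf y = - ((norm (gradf y))\<^sup>2 / L)"
    by (simp add: power2_norm_eq_inner)
  moreover have "L / 2 * (norm ?h)\<^sup>2 = (norm (gradf y))\<^sup>2 / (2 * L)"
    using L_pos by (simp add: power_divide power2_eq_square)
  moreover have "(norm (gradf y))\<^sup>2 / L = 2 * ((norm (gradf y))\<^sup>2 / (2 * L))"
    by simp
  ultimately have "(norm (gradf y))\<^sup>2 / (2 * L) \<le> f y - f xstar"
    using minimizer[of "y + ?h"] by linarith
  then show ?thesis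
    using L_pos by (simp add: field_simps)
qed

lemma minimizer_upper: "f (xstar + h) \<le> f xstar + L / 2 * (norm h)\<^sup>2"
proof -
  have "gradf xstar = 0"
    using norm_gradf_sq_le_gap[of xstar] by simp
  then show ?thesis
    using abs_le_D1[OF smooth_with_quadratic_remainder[OF f_smooth, of xstar h]] by simp
qed

text \<open>The decomposition of the second moment into squared mean and variance. The sharp form, without the
factor \<open>2\<close> of \<open>(norm (a + b))\<^sup>2 \<le> 2 (norm a)\<^sup>2 + 2 (norm b)\<^sup>2\<close>, keeps the constants of the final bound
small enough.\<close>

lemma gradF_second_moment:
  "integrable D (\<lambda>s. (norm (gradF y s))\<^sup>2)"
  "(\<integral>s. (norm (gradF y s))\<^sup>2 \<partial>D) \<le> (norm (gradf y))\<^sup>2 + \<sigma>1\<^sup>2"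
proof -
  have eq: "(norm (gradF y s))\<^sup>2
      = (norm (gradF y s - gradf y))\<^sup>2 + 2 * (gradF y s \<bullet> gradf y) - (norm (gradf y))\<^sup>2" for s
    by (simp add: power2_norm_eq_inner inner_diff_left inner_diff_right inner_commute)
  have int: "integrable D (\<lambda>s. gradF y s \<bullet> gradf y)"
    using integrable_gradF by simp
  show "integrable D (\<lambda>s. (norm (gradF y s))\<^sup>2)"
    unfolding eq using integrable_gradient_sq int by simp
  have "(\<integral>s. gradF y s \<bullet> gradf y \<partial>D) = (norm (gradf y))\<^sup>2"
    using integrable_gradF gradf_eq[of y] by (simp add: power2_norm_eq_inner)
  then have "(\<integral>s. (norm (gradF y s))\<^sup>2 \<partial>D)
      = (\<integral>s. (norm (gradF y s - gradf y))\<^sup>2 \<partial>D) + (norm (gradf y))\<^sup>2"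
    unfolding eq using integrable_gradient_sq int by (simp add: prob_space)
  then show "(\<integral>s. (norm (gradF y s))\<^sup>2 \<partial>D) \<le> (norm (gradf y))\<^sup>2 + \<sigma>1\<^sup>2"
    using gradient_variance[of y] by simp
qed

abbreviation sample :: "('a \<times> 's) measure" where
  "sample \<equiv> uniform_unit_sphere \<Otimes>\<^sub>M D"

lemma pair_prob_space_sample: "pair_prob_space (uniform_unit_sphere :: 'a measure) D"
  by (intro pair_prob_space.intro pair_sigma_finite.intro prob_space_imp_sigma_finite
      prob_space_uniform_unit_sphere prob_space_axioms)

lemma sample_value_noise:
  "(\<integral>\<^sup>+p. ennreal ((F y (snd p) - f y)\<^sup>2) \<partial>sample) \<le> ennreal (\<sigma>0\<^sup>2)"
proof -
  interpret S: prob_space "uniform_unit_sphere :: 'a measure"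
    by (rule prob_space_uniform_unit_sphere)
  have "(\<integral>\<^sup>+p. ennreal ((F y (snd p) - f y)\<^sup>2) \<partial>sample)
      = (\<integral>\<^sup>+u. \<integral>\<^sup>+s. ennreal ((F y s - f y)\<^sup>2) \<partial>D \<partial>(uniform_unit_sphere :: 'a measure))"
    by (subst nn_integral_fst[symmetric]) auto
  also have "\<dots> = ennreal (\<integral>s. (F y s - f y)\<^sup>2 \<partial>D)"
    using integrable_value_sq S.emeasure_space_1 by (simp add: nn_integral_eq_integral)
  finally show ?thesis
    using value_variance by (simp add: ennreal_leI)
qed

text \<open>A uniform direction sees only the fraction \<open>1 / DIM('a)\<close> of the squared length of a fixed vector.\<close>

lemma sample_directional_derivative:
  "(\<integral>\<^sup>+p. ennreal ((gradF y (snd p) \<bullet> fst p)\<^sup>2) \<partial>sample)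
    \<le> ennreal (((norm (gradf y))\<^sup>2 + \<sigma>1\<^sup>2) / real DIM('a))"
proof -
  interpret S: prob_space "uniform_unit_sphere :: 'a measure"
    by (rule prob_space_uniform_unit_sphere)
  interpret P: pair_prob_space "uniform_unit_sphere :: 'a measure" D
    by (rule pair_prob_space_sample)
  have inner: "(\<integral>\<^sup>+u. ennreal ((w \<bullet> u)\<^sup>2) \<partial>uniform_unit_sphere) = ennreal ((norm w)\<^sup>2 / real DIM('a))" for w :: 'a
  proof -
    have "integrable uniform_unit_sphere (\<lambda>u. (w \<bullet> u)\<^sup>2)"
    proof (rule S.integrable_const_bound)
      show "AE u in uniform_unit_sphere. norm ((w \<bullet> u)\<^sup>2) \<le> (norm w)\<^sup>2"
        using AE_uniform_unit_sphere
      proof eventually_elim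
        case (elim u)
        then have "\<bar>w \<bullet> u\<bar> \<le> norm w"
          using Cauchy_Schwarz_ineq2[of w u] by simp
        then show ?case
          by (simp add: abs_le_square_iff[symmetric])
      qed
    qed simp
    then show ?thesis
      by (simp add: nn_integral_eq_integral integral_inner_sq_uniform_unit_sphere)
  qed
  have "(\<integral>\<^sup>+p. ennreal ((gradF y (snd p) \<bullet> fst p)\<^sup>2) \<partial>sample)
      = (\<integral>\<^sup>+s. \<integral>\<^sup>+u. ennreal ((gradF y s \<bullet> u)\<^sup>2) \<partial>uniform_unit_sphere \<partial>D)"
    by (subst P.nn_integral_snd[symmetric]) auto
  also have "\<dots> = (\<integral>\<^sup>+s. ennreal ((norm (gradF y s))\<^sup>2 / real DIM('a)) \<partial>D)"
    by (simp add: inner)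
  also have "\<dots> = ennreal ((\<integral>s. (norm (gradF y s))\<^sup>2 \<partial>D) / real DIM('a))"
    using gradF_second_moment(1) by (simp add: nn_integral_eq_integral)
  also have "\<dots> \<le> ennreal (((norm (gradf y))\<^sup>2 + \<sigma>1\<^sup>2) / real DIM('a))"
    using gradF_second_moment(2) by (intro ennreal_leI divide_right_mono) auto
  finally show ?thesis .
qed

text \<open>The constant \<open>c\<close> stands for the previous value that is subtracted in the estimate. It is known
before \<open>u\<close> is drawn and drops out because \<open>u\<close> has mean \<open>0\<close>.\<close>

lemma sample_descent:
  assumes "0 < \<alpha>"
  shows "f y - f xstar - L * \<alpha>\<^sup>2 / 2 \<le>
    (\<integral>p. real DIM('a) / \<alpha> * ((F (y + \<alpha> *\<^sub>R fst p) (snd p) - c) * ((y - xstar) \<bullet> fst p)) \<partial>sample)"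
proof -
  interpret S: prob_space "uniform_unit_sphere :: 'a measure"
    by (rule prob_space_uniform_unit_sphere)
  interpret P: pair_prob_space "uniform_unit_sphere :: 'a measure" D
    by (rule pair_prob_space_sample)
  let ?w = "y - xstar"
  let ?K = "\<lambda>u s. (F (y + \<alpha> *\<^sub>R u) s - c) * (?w \<bullet> u)"
  have w_le: "\<bar>?w \<bullet> u\<bar> \<le> norm ?w" if "norm u = 1" for u
    using Cauchy_Schwarz_ineq2[of ?w u] that by simp
  have f_le: "\<bar>f (y + \<alpha> *\<^sub>R u)\<bar> \<le> \<bar>f y\<bar> + L0 * \<alpha>" if "norm u = 1" for u
    using lipschitz_onD[OF f_lipschitz, of "y + \<alpha> *\<^sub>R u" y] that \<open>0 < \<alpha>\<close> by (simp add: dist_norm)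
  have F_le: "(\<integral>s. \<bar>F z s - c\<bar> \<partial>D) \<le> \<bar>f z\<bar> + (1 + \<sigma>0\<^sup>2 + \<bar>c\<bar>)" for z
  proof -
    have "(\<integral>s. \<bar>F z s - c\<bar> \<partial>D) \<le> (\<integral>s. (F z s - f z)\<^sup>2 + (1 + \<bar>f z\<bar> + \<bar>c\<bar>) \<partial>D)"
    proof (rule integral_mono)
      fix s
      have "\<bar>a\<bar> \<le> 1 + a\<^sup>2" for a :: real
        using zero_le_power2[of "\<bar>a\<bar> - 1/2"] by (simp add: power2_eq_square algebra_simps)
      from this[of "F z s - f z"] show "\<bar>F z s - c\<bar> \<le> (F z s - f z)\<^sup>2 + (1 + \<bar>f z\<bar> + \<bar>c\<bar>)"
        by (simp add: abs_le_iff) linarith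
    qed (use integrable_F integrable_value_sq in auto)
    then show ?thesis
      using value_variance[of z] integrable_value_sq by (simp add: prob_space)
  qed
  have int: "integrable sample (\<lambda>(u, s). ?K u s)"
  proof (rule P.Fubini_integrable)
    show "integrable uniform_unit_sphere (\<lambda>u. \<integral>s. norm (case (u, s) of (u, s) \<Rightarrow> ?K u s) \<partial>D)"
    proof (rule S.integrable_const_bound)
      show "AE u in uniform_unit_sphere. norm (\<integral>s. norm (case (u, s) of (u, s) \<Rightarrow> ?K u s) \<partial>D)
          \<le> (\<bar>f y\<bar> + L0 * \<alpha> + (1 + \<sigma>0\<^sup>2 + \<bar>c\<bar>)) * norm ?w"
        using AE_uniform_unit_sphere
      proof eventually_elim
        case (elim u)
        have "(\<integral>s. \<bar>F (y + \<alpha> *\<^sub>R u) s - c\<bar> \<partial>D) * \<bar>?w \<bullet> u\<bar>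
            \<le> (\<bar>f y\<bar> + L0 * \<alpha> + (1 + \<sigma>0\<^sup>2 + \<bar>c\<bar>)) * norm ?w"
          using F_le[of "y + \<alpha> *\<^sub>R u"] f_le[OF elim] lipschitz_on_nonneg[OF f_lipschitz] \<open>0 < \<alpha>\<close>
          by (intro mult_mono w_le elim) (auto intro: add_nonneg_nonneg)
        then show ?case
          by (simp add: abs_mult)
      qed
    qed measurable
  qed (use integrable_F in auto)
  have "(\<integral>p. (F (y + \<alpha> *\<^sub>R fst p) (snd p) - c) * (?w \<bullet> fst p) \<partial>sample) = (\<integral>u. \<integral>s. ?K u s \<partial>D \<partial>uniform_unit_sphere)"
    using P.integral_fst'[OF int] by (simp add: case_prod_unfold)
  also have "\<dots> = (\<integral>u. f (y + \<alpha> *\<^sub>R u) * (?w \<bullet> u) - c * (?w \<bullet> u) \<partial>uniform_unit_sphere)"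
    using integrable_F by (simp add: prob_space f_eq[symmetric] left_diff_distrib)
  also have "\<dots> = (\<integral>u. f (y + \<alpha> *\<^sub>R u) * (?w \<bullet> u) \<partial>uniform_unit_sphere)"
  proof (subst Bochner_Integration.integral_diff)
    show "integrable uniform_unit_sphere (\<lambda>u. f (y + \<alpha> *\<^sub>R u) * (?w \<bullet> u))"
    proof (rule S.integrable_const_bound)
      show "AE u in uniform_unit_sphere. norm (f (y + \<alpha> *\<^sub>R u) * (?w \<bullet> u)) \<le> (\<bar>f y\<bar> + L0 * \<alpha>) * norm ?w"
        using AE_uniform_unit_sphere
        by eventually_elim
           (use f_le w_le lipschitz_on_nonneg[OF f_lipschitz] \<open>0 < \<alpha>\<close> in \<open>auto simp: abs_mult intro!: mult_mono\<close>)
    qed simp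
    show "integrable uniform_unit_sphere (\<lambda>u. c * (?w \<bullet> u))"
    proof (rule S.integrable_const_bound)
      show "AE u in uniform_unit_sphere. norm (c * (?w \<bullet> u)) \<le> \<bar>c\<bar> * norm ?w"
        using AE_uniform_unit_sphere
        by eventually_elim (use w_le in \<open>auto simp: abs_mult intro!: mult_left_mono\<close>)
    qed simp
  qed (simp add: integral_inner_uniform_unit_sphere)
  finally show ?thesis
    using sphere_smoothing_descent[OF f_convex GDERIV_gradf gradf_continuous minimizer_upper \<open>0 < \<alpha>\<close>, of y]
      L_pos by simp
qed

end

section \<open>Independence of the past from fresh samples\<close>

lemma (in prob_space) distr_Pair_eqI:
  assumes [measurable]: "X \<in> measurable M N1" "Y \<in> measurable M N2"
    and indep: "\<And>A B. A \<in> sets N1 \<Longrightarrow> B \<in> sets N2 \<Longrightarrow>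
      prob ((X -` A \<inter> space M) \<inter> (Y -` B \<inter> space M)) = prob (X -` A \<inter> space M) * prob (Y -` B \<inter> space M)"
  shows "distr M (N1 \<Otimes>\<^sub>M N2) (\<lambda>\<omega>. (X \<omega>, Y \<omega>)) = distr M N1 X \<Otimes>\<^sub>M distr M N2 Y"
proof (rule pair_measure_eqI[symmetric])
  show "sigma_finite_measure (distr M N1 X)" "sigma_finite_measure (distr M N2 Y)"
    by (auto intro!: prob_space_imp_sigma_finite prob_space_distr)
  fix A B assume "A \<in> sets (distr M N1 X)" "B \<in> sets (distr M N2 Y)"
  then have AB [measurable]: "A \<in> sets N1" "B \<in> sets N2"
    by auto
  have "(\<lambda>\<omega>. (X \<omega>, Y \<omega>)) -` (A \<times> B) \<inter> space M = (X -` A \<inter> space M) \<inter> (Y -` B \<inter> space M)"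
    by auto
  with indep[OF AB] show "emeasure (distr M N1 X) A * emeasure (distr M N2 Y) B
      = emeasure (distr M (N1 \<Otimes>\<^sub>M N2) (\<lambda>\<omega>. (X \<omega>, Y \<omega>))) (A \<times> B)"
    by (simp add: emeasure_distr emeasure_eq_measure ennreal_mult)
qed (simp cong: sets_pair_measure_cong)

lemma (in prob_space) indep_pairD:
  assumes "indep_pair M S X S' Y" "A \<in> sets S" "B \<in> sets S'"
  shows "prob ((X -` A \<inter> space M) \<inter> (Y -` B \<inter> space M)) = prob (X -` A \<inter> space M) * prob (Y -` B \<inter> space M)"
  using assms unfolding indep_pair_def by (intro indep_setD) auto

lemma (in prob_space) indep_pair_component:
  assumes indep: "indep_pair M (PiM I (\<lambda>_. N1)) (\<lambda>\<omega>. \<lambda>i\<in>I. X i \<omega>) (PiM I (\<lambda>_. N2)) (\<lambda>\<omega>. \<lambda>i\<in>I. Y i \<omega>)"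
    and "j \<in> I" and [measurable]: "A \<in> sets N1" "B \<in> sets N2"
  shows "prob ((X j -` A \<inter> space M) \<inter> (Y j -` B \<inter> space M)) = prob (X j -` A \<inter> space M) * prob (Y j -` B \<inter> space M)"
proof -
  have X: "(\<lambda>\<omega>. \<lambda>i\<in>I. X i \<omega>) \<in> measurable M (PiM I (\<lambda>_. N1))"
    and Y: "(\<lambda>\<omega>. \<lambda>i\<in>I. Y i \<omega>) \<in> measurable M (PiM I (\<lambda>_. N2))"
    using indep by (auto simp: indep_pair_def)
  let ?A = "{p \<in> space (PiM I (\<lambda>_. N1)). p j \<in> A}" and ?B = "{p \<in> space (PiM I (\<lambda>_. N2)). p j \<in> B}"
  have "?A \<in> sets (PiM I (\<lambda>_. N1))" "?B \<in> sets (PiM I (\<lambda>_. N2))"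
    using \<open>j \<in> I\<close> by measurable
  note indep_pairD[OF indep this]
  moreover have "(\<lambda>\<omega>. \<lambda>i\<in>I. X i \<omega>) -` ?A \<inter> space M = X j -` A \<inter> space M"
    using \<open>j \<in> I\<close> measurable_space[OF X] by auto
  moreover have "(\<lambda>\<omega>. \<lambda>i\<in>I. Y i \<omega>) -` ?B \<inter> space M = Y j -` B \<inter> space M"
    using \<open>j \<in> I\<close> measurable_space[OF Y] by auto
  ultimately show ?thesis
    by simp
qed

text \<open>Independence of the two families, and of each family within itself, makes the pairs independent.
It suffices to check rectangles, which generate the product \<open>\<sigma>\<close>-algebra, and there every probability
factorizes twice.\<close>

lemma (in prob_space) indep_vars_Pair:
  assumes "finite I" "I \<noteq> {}"
    and X: "indep_vars (\<lambda>_. N1) X I" and Y: "indep_vars (\<lambda>_. N2) Y I"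
    and indep: "indep_pair M (PiM I (\<lambda>_. N1)) (\<lambda>\<omega>. \<lambda>i\<in>I. X i \<omega>) (PiM I (\<lambda>_. N2)) (\<lambda>\<omega>. \<lambda>i\<in>I. Y i \<omega>)"
  shows "indep_vars (\<lambda>_. N1 \<Otimes>\<^sub>M N2) (\<lambda>i \<omega>. (X i \<omega>, Y i \<omega>)) I"
proof -
  have X_rv [measurable]: "X i \<in> measurable M N1" and Y_rv [measurable]: "Y i \<in> measurable M N2" if "i \<in> I" for i
    using X Y that by (auto simp: indep_vars_def)
  let ?E = "{a \<times> b |a b. a \<in> sets N1 \<and> b \<in> sets N2}"
  have "\<forall>A\<in>I \<rightarrow> ?E. prob (\<Inter>i\<in>I. (\<lambda>\<omega>. (X i \<omega>, Y i \<omega>)) -` A i \<inter> space M)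
      = (\<Prod>i\<in>I. prob ((\<lambda>\<omega>. (X i \<omega>, Y i \<omega>)) -` A i \<inter> space M))"
  proof
    fix A assume "A \<in> I \<rightarrow> ?E"
    then have "\<forall>i\<in>I. \<exists>a b. A i = a \<times> b \<and> a \<in> sets N1 \<and> b \<in> sets N2"
      by blast
    then obtain a b where A: "\<And>i. i \<in> I \<Longrightarrow> A i = a i \<times> b i"
      and a: "\<And>i. i \<in> I \<Longrightarrow> a i \<in> sets N1" and b: "\<And>i. i \<in> I \<Longrightarrow> b i \<in> sets N2"
      by metis
    have single: "(\<lambda>\<omega>. (X i \<omega>, Y i \<omega>)) -` A i \<inter> space M = (X i -` a i \<inter> space M) \<inter> (Y i -` b i \<inter> space M)"
      if "i \<in> I" for i
      using A[OF that] by auto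
    have X': "(\<lambda>\<omega>. \<lambda>i\<in>I. X i \<omega>) -` (Pi\<^sub>E I a) \<inter> space M = (\<Inter>i\<in>I. X i -` a i \<inter> space M)"
      and Y': "(\<lambda>\<omega>. \<lambda>i\<in>I. Y i \<omega>) -` (Pi\<^sub>E I b) \<inter> space M = (\<Inter>i\<in>I. Y i -` b i \<inter> space M)"
      using \<open>I \<noteq> {}\<close> by (auto simp: PiE_iff)
    have "(\<Inter>i\<in>I. (\<lambda>\<omega>. (X i \<omega>, Y i \<omega>)) -` A i \<inter> space M)
        = (\<Inter>i\<in>I. X i -` a i \<inter> space M) \<inter> (\<Inter>i\<in>I. Y i -` b i \<inter> space M)"
      using single by auto
    also have "prob \<dots> = prob (\<Inter>i\<in>I. X i -` a i \<inter> space M) * prob (\<Inter>i\<in>I. Y i -` b i \<inter> space M)"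
      using indep_pairD[OF indep, of "Pi\<^sub>E I a" "Pi\<^sub>E I b"] a b \<open>finite I\<close>
      unfolding X' Y' by (auto intro!: sets_PiM_I_finite)
    also have "\<dots> = (\<Prod>i\<in>I. prob (X i -` a i \<inter> space M)) * (\<Prod>i\<in>I. prob (Y i -` b i \<inter> space M))"
      using indep_varsD_finite[OF X \<open>I \<noteq> {}\<close> \<open>finite I\<close> a] indep_varsD_finite[OF Y \<open>I \<noteq> {}\<close> \<open>finite I\<close> b]
      by simp
    also have "\<dots> = (\<Prod>i\<in>I. prob ((\<lambda>\<omega>. (X i \<omega>, Y i \<omega>)) -` A i \<inter> space M))"
      unfolding prod.distrib[symmetric]
      by (intro prod.cong refl) (simp add: single indep_pair_component[OF indep _ a b])
    finally show "prob (\<Inter>i\<in>I. (\<lambda>\<omega>. (X i \<omega>, Y i \<omega>)) -` A i \<inter> space M)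
      = (\<Prod>i\<in>I. prob ((\<lambda>\<omega>. (X i \<omega>, Y i \<omega>)) -` A i \<inter> space M))" .
  qed
  moreover have "space (N1 \<Otimes>\<^sub>M N2) \<in> ?E"
    unfolding space_pair_measure by blast
  moreover have "?E \<subseteq> Pow (space (N1 \<Otimes>\<^sub>M N2))"
    using pair_measure_closed by (simp add: space_pair_measure)
  ultimately show ?thesis
    using \<open>finite I\<close> \<open>I \<noteq> {}\<close>
    by (subst indep_vars_finite[where E = "\<lambda>_. ?E"])
       (auto simp: sets_pair_measure space_pair_measure Int_stable_pair_measure_generator)
qed

text \<open>A function of \<open>W 0, \<dots>, W (t - 1)\<close> and the sample \<open>W t\<close> have a product law. Stated for joint laws instead
of \<open>indep_var\<close>, because the two random variables have values in different types.\<close>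

lemma (in prob_space) distr_past_fresh:
  assumes indep: "indep_vars (\<lambda>_. N) W {..T::nat}" and t: "t \<le> T"
    and \<phi>: "\<phi> \<in> measurable (PiM {..<t} (\<lambda>_. N)) N'"
  shows "distr M (N' \<Otimes>\<^sub>M N) (\<lambda>\<omega>. (\<phi> (\<lambda>i\<in>{..<t}. W i \<omega>), W t \<omega>))
    = distr M N' (\<lambda>\<omega>. \<phi> (\<lambda>i\<in>{..<t}. W i \<omega>)) \<Otimes>\<^sub>M distr M N (W t)"
proof (rule distr_Pair_eqI)
  let ?H = "\<lambda>A \<omega>. \<lambda>i\<in>A. W i \<omega>"
  have ind: "indep_var (PiM {..<t} (\<lambda>_. N)) (?H {..<t}) (PiM {t} (\<lambda>_. N)) (?H {t})"
    using t by (intro indep_var_restrict[OF indep]) auto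
  note [measurable] = indep_var_rv1[OF ind]
  have W [measurable]: "W t \<in> measurable M N"
    using indep t by (auto simp: indep_vars_def)
  show "(\<lambda>\<omega>. \<phi> (?H {..<t} \<omega>)) \<in> measurable M N'"
    using measurable_compose[OF indep_var_rv1[OF ind] \<phi>] .
  show "W t \<in> measurable M N" by fact
  fix A B assume A: "A \<in> sets N'" and B: "B \<in> sets N"
  let ?A = "\<phi> -` A \<inter> space (PiM {..<t} (\<lambda>_. N))" and ?B = "{p \<in> space (PiM {t} (\<lambda>_. N)). p t \<in> B}"
  have "?A \<in> sets (PiM {..<t} (\<lambda>_. N))"
    using \<phi> A by (rule measurable_sets)
  moreover have "?B \<in> sets (PiM {t} (\<lambda>_. N))"
    using B by measurable
  ultimately have "prob ((\<lambda>\<omega>. (?H {..<t} \<omega>, ?H {t} \<omega>)) -` (?A \<times> ?B) \<inter> space M)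
      = prob (?H {..<t} -` ?A \<inter> space M) * prob (?H {t} -` ?B \<inter> space M)"
    by (rule indep_varD[OF ind])
  moreover have "?H {..<t} -` ?A \<inter> space M = (\<lambda>\<omega>. \<phi> (?H {..<t} \<omega>)) -` A \<inter> space M"
    using measurable_space[OF indep_var_rv1[OF ind]] by auto
  moreover have "?H {t} -` ?B \<inter> space M = W t -` B \<inter> space M"
    using measurable_space[OF indep_var_rv2[OF ind]] by auto
  moreover have "(\<lambda>\<omega>. (?H {..<t} \<omega>, ?H {t} \<omega>)) -` (?A \<times> ?B) \<inter> space M
      = (?H {..<t} -` ?A \<inter> space M) \<inter> (?H {t} -` ?B \<inter> space M)"
    by auto
  ultimately show "prob (((\<lambda>\<omega>. \<phi> (?H {..<t} \<omega>)) -` A \<inter> space M) \<inter> (W t -` B \<inter> space M))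
      = prob ((\<lambda>\<omega>. \<phi> (?H {..<t} \<omega>)) -` A \<inter> space M) * prob (W t -` B \<inter> space M)"
    by simp
qed

text \<open>Conditioning on \<open>Z\<close> in the form of the theorem of Tonelli: a bound of the integral over \<open>Y\<close> for every
fixed value of \<open>Z\<close> gives integrability as well as a bound of the expectation.\<close>

lemma (in prob_space) integral_le_if_indep:
  fixes K :: "'b \<times> 'c \<Rightarrow> real"
  assumes joint: "distr M (N' \<Otimes>\<^sub>M N) (\<lambda>\<omega>. (Z \<omega>, Y \<omega>)) = distr M N' Z \<Otimes>\<^sub>M Q" and Q: "prob_space Q"
    and [measurable]: "Z \<in> measurable M N'" "Y \<in> measurable M N" "K \<in> borel_measurable (N' \<Otimes>\<^sub>M N)"
    and sets_Q [measurable_cong]: "sets Q = sets N"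
    and nonneg: "\<And>p. 0 \<le> K p"
    and le: "\<And>z. z \<in> space N' \<Longrightarrow> (\<integral>\<^sup>+q. ennreal (K (z, q)) \<partial>Q) \<le> ennreal (B z)"
    and B: "integrable M (\<lambda>\<omega>. B (Z \<omega>))" "\<And>\<omega>. 0 \<le> B (Z \<omega>)" and [measurable]: "B \<in> borel_measurable N'"
  shows "integrable M (\<lambda>\<omega>. K (Z \<omega>, Y \<omega>)) \<and> (\<integral>\<omega>. K (Z \<omega>, Y \<omega>) \<partial>M) \<le> (\<integral>\<omega>. B (Z \<omega>) \<partial>M)"
proof -
  interpret Q: prob_space Q by (rule Q)
  have "(\<integral>\<^sup>+\<omega>. ennreal (K (Z \<omega>, Y \<omega>)) \<partial>M) = (\<integral>\<^sup>+p. ennreal (K p) \<partial>distr M (N' \<Otimes>\<^sub>M N) (\<lambda>\<omega>. (Z \<omega>, Y \<omega>)))"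
    by (subst nn_integral_distr) auto
  also have "\<dots> = (\<integral>\<^sup>+z. \<integral>\<^sup>+q. ennreal (K (z, q)) \<partial>Q \<partial>distr M N' Z)"
    unfolding joint by (subst Q.nn_integral_fst[symmetric]) auto
  also have "\<dots> \<le> (\<integral>\<^sup>+z. ennreal (B z) \<partial>distr M N' Z)"
    using le by (intro nn_integral_mono) auto
  also have "\<dots> = (\<integral>\<^sup>+\<omega>. ennreal (B (Z \<omega>)) \<partial>M)"
    by (subst nn_integral_distr) auto
  also have "\<dots> = ennreal (\<integral>\<omega>. B (Z \<omega>) \<partial>M)"
    using B by (intro nn_integral_eq_integral) auto
  finally have nn: "(\<integral>\<^sup>+\<omega>. ennreal (K (Z \<omega>, Y \<omega>)) \<partial>M) \<le> ennreal (\<integral>\<omega>. B (Z \<omega>) \<partial>M)" .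
  have int: "integrable M (\<lambda>\<omega>. K (Z \<omega>, Y \<omega>))"
    using le_less_trans[OF nn ennreal_less_top] nonneg by (intro integrableI_nonneg) auto
  then show ?thesis
    using nn nonneg B by (simp add: nn_integral_eq_integral[OF int] ennreal_le_iff integral_nonneg)
qed

text \<open>The counterpart for integrands without a sign, where integrability has to be known beforehand.\<close>

lemma (in prob_space) integral_ge_if_indep:
  fixes K :: "'b \<times> 'c \<Rightarrow> real"
  assumes joint: "distr M (N' \<Otimes>\<^sub>M N) (\<lambda>\<omega>. (Z \<omega>, Y \<omega>)) = distr M N' Z \<Otimes>\<^sub>M Q" and Q: "prob_space Q"
    and [measurable]: "Z \<in> measurable M N'" "Y \<in> measurable M N" "K \<in> borel_measurable (N' \<Otimes>\<^sub>M N)"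
    and sets_Q [measurable_cong]: "sets Q = sets N"
    and K: "integrable M (\<lambda>\<omega>. K (Z \<omega>, Y \<omega>))"
    and ge: "\<And>z. z \<in> space N' \<Longrightarrow> B z \<le> (\<integral>q. K (z, q) \<partial>Q)"
    and B: "integrable M (\<lambda>\<omega>. B (Z \<omega>))" and [measurable]: "B \<in> borel_measurable N'"
  shows "(\<integral>\<omega>. B (Z \<omega>) \<partial>M) \<le> (\<integral>\<omega>. K (Z \<omega>, Y \<omega>) \<partial>M)"
proof -
  interpret Q: prob_space Q by (rule Q)
  interpret Z: prob_space "distr M N' Z" by (rule prob_space_distr) simp
  interpret P: pair_prob_space "distr M N' Z" Q ..
  have int: "integrable (distr M N' Z \<Otimes>\<^sub>M Q) K"
    unfolding joint[symmetric] using K by (subst integrable_distr_eq) auto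
  have "(\<integral>\<omega>. B (Z \<omega>) \<partial>M) = (\<integral>z. B z \<partial>distr M N' Z)"
    by (subst integral_distr) auto
  also have "\<dots> \<le> (\<integral>z. \<integral>q. K (z, q) \<partial>Q \<partial>distr M N' Z)"
    using ge B by (intro integral_mono P.integrable_fst'[OF int]) (auto simp: integrable_distr_eq)
  also have "\<dots> = (\<integral>p. K p \<partial>(distr M N' Z \<Otimes>\<^sub>M Q))"
    by (rule P.integral_fst'[OF int])
  also have "\<dots> = (\<integral>\<omega>. K (Z \<omega>, Y \<omega>) \<partial>M)"
    unfolding joint[symmetric] by (subst integral_distr) auto
  finally show ?thesis .
qed

text \<open>The iterate at time \<open>t\<close> depends only on the samples before time \<open>t\<close>.\<close>

lemma residual_iterate_cong:
  "(\<And>i. i < t \<Longrightarrow> u i = u' i) \<Longrightarrow> (\<And>i. i < t \<Longrightarrow> s i = s' i) \<Longrightarrow>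
    residual_iterate F \<alpha> \<eta> x1 u s t = residual_iterate F \<alpha> \<eta> x1 u' s' t"
proof (induction t rule: less_induct)
  case (less t)
  consider "t = 0" | "t = Suc 0" | n where "t = Suc (Suc n)"
    by (cases t; cases "t - 1") auto
  then show ?case
  proof cases
    case 3
    then have "residual_iterate F \<alpha> \<eta> x1 u s n = residual_iterate F \<alpha> \<eta> x1 u' s' n"
      "residual_iterate F \<alpha> \<eta> x1 u s (Suc n) = residual_iterate F \<alpha> \<eta> x1 u' s' (Suc n)"
      using less by auto
    with 3 less.prems show ?thesis
      by simp
  qed auto
qed

lemma (in stochastic_objective) measurable_residual_iterate:
  assumes "{..<t} \<subseteq> J"
  shows "(\<lambda>p. residual_iterate F \<alpha> \<eta> x1 (\<lambda>i. fst (p i)) (\<lambda>i. snd (p i)) t)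
    \<in> borel_measurable (PiM J (\<lambda>_. borel \<Otimes>\<^sub>M D))"
  using assms
proof (induction t rule: less_induct)
  case (less t)
  consider "t = 0" | "t = Suc 0" | n where "t = Suc (Suc n)"
    by (cases t; cases "t - 1") auto
  then show ?case
  proof cases
    case 3
    then have J: "n \<in> J" "Suc n \<in> J"
      using less.prems by auto
    have [measurable]: "(\<lambda>p. residual_iterate F \<alpha> \<eta> x1 (\<lambda>i. fst (p i)) (\<lambda>i. snd (p i)) n)
        \<in> borel_measurable (PiM J (\<lambda>_. borel \<Otimes>\<^sub>M D))"
      "(\<lambda>p. residual_iterate F \<alpha> \<eta> x1 (\<lambda>i. fst (p i)) (\<lambda>i. snd (p i)) (Suc n))
        \<in> borel_measurable (PiM J (\<lambda>_. borel \<Otimes>\<^sub>M D))"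
      using 3 less.prems by (auto intro!: less.IH)
    note [measurable] = measurable_component_singleton[OF J(1), of "\<lambda>_. borel \<Otimes>\<^sub>M D"]
      measurable_component_singleton[OF J(2), of "\<lambda>_. borel \<Otimes>\<^sub>M D"]
    show ?thesis
      unfolding 3 residual_iterate.simps residual_estimate_def by measurable
  qed auto
qed

section \<open>Real inequalities for the residual recursion\<close>

text \<open>The numbers \<open>y\<close> and \<open>y'\<close> are two observed values, each known up to \<open>r\<close> from the value \<open>a\<close> of the
objective, the noise \<open>n\<close> and the slope \<open>s\<close>. The parts \<open>n - n'\<close>, \<open>a - a'\<close>, \<open>\<alpha> (s - s')\<close> and the
remainder are separated by the inequality between the arithmetic and the quadratic mean.\<close>

lemma residual_difference_sq_le:
  fixes y y' a a' n n' s s' \<alpha> r :: real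
  assumes "\<bar>y - (a + n + \<alpha> * s)\<bar> \<le> r" "\<bar>y' - (a' + n' + \<alpha> * s')\<bar> \<le> r"
  shows "(y - y')\<^sup>2 \<le> 4 * (2 * n\<^sup>2 + 2 * n'\<^sup>2 + (a - a')\<^sup>2 + 2 * \<alpha>\<^sup>2 * (s\<^sup>2 + s'\<^sup>2) + 4 * r\<^sup>2)"
proof -
  define e where "e = (y - (a + n + \<alpha> * s)) - (y' - (a' + n' + \<alpha> * s'))"
  have two: "(p - q)\<^sup>2 \<le> 2 * p\<^sup>2 + 2 * q\<^sup>2" for p q :: real
    using zero_le_power2[of "p + q"] by (simp add: power2_eq_square algebra_simps)
  have four: "(p + q + m + e)\<^sup>2 \<le> 4 * (p\<^sup>2 + q\<^sup>2 + m\<^sup>2 + e\<^sup>2)" for p q m e :: real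
    using zero_le_power2[of "p - q"] zero_le_power2[of "p - m"] zero_le_power2[of "p - e"]
      zero_le_power2[of "q - m"] zero_le_power2[of "q - e"] zero_le_power2[of "m - e"]
    by (simp add: power2_eq_square algebra_simps)
  have "\<bar>e\<bar> \<le> \<bar>2 * r\<bar>"
    using assms unfolding e_def by linarith
  then have e: "e\<^sup>2 \<le> 4 * r\<^sup>2"
    by (simp only: abs_le_square_iff) (simp add: power_mult_distrib)
  have "y - y' = (n - n') + (a - a') + \<alpha> * (s - s') + e"
    by (simp add: e_def algebra_simps)
  then have split: "(y - y')\<^sup>2 \<le> 4 * ((n - n')\<^sup>2 + (a - a')\<^sup>2 + (\<alpha> * (s - s'))\<^sup>2 + e\<^sup>2)"
    by (simp only: four)
  have slopes: "(\<alpha> * (s - s'))\<^sup>2 \<le> 2 * \<alpha>\<^sup>2 * (s\<^sup>2 + s'\<^sup>2)"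
    using mult_left_mono[OF two[of s s'] zero_le_power2[of \<alpha>]] by (simp only: power_mult_distrib distrib_left mult_ac)
  have "4 * ((n - n')\<^sup>2 + (a - a')\<^sup>2 + (\<alpha> * (s - s'))\<^sup>2 + e\<^sup>2)
      \<le> 4 * ((2 * n\<^sup>2 + 2 * n'\<^sup>2) + (a - a')\<^sup>2 + 2 * \<alpha>\<^sup>2 * (s\<^sup>2 + s'\<^sup>2) + 4 * r\<^sup>2)"
    by (intro mult_left_mono add_mono order_refl two slopes e) auto
  with split show ?thesis
    by (rule order_trans)
qed

text \<open>The deterministic end of the argument. In the application, \<open>V t\<close> is the second moment of the step from
\<open>x t\<close> to \<open>x (t+1)\<close>, \<open>N t\<close> that of the gradient at \<open>x t\<close>, \<open>R t\<close> that of \<open>x t - xstar\<close>, and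
\<open>P t\<close> the expected gap minus \<open>L \<alpha>\<^sup>2 / 2\<close>. Summing the recursion of \<open>V\<close> and inserting the bound of
\<open>N\<close> by \<open>P\<close> gives \<open>\<Sum>V \<le> (16/15) (E + (\<eta>/2) \<Sum>P)\<close> when \<open>\<Sum>P > 0\<close>, and this is absorbed in
\<open>2 \<eta> \<Sum>P \<le> R 1 + \<Sum>V\<close>. If \<open>\<Sum>P \<le> 0\<close> there is nothing to absorb.\<close>

lemma summed_descent_bound:
  fixes V N P R :: "nat \<Rightarrow> real"
  assumes V0: "V 0 = 0" "\<And>t. 0 \<le> V t"
    and V: "\<And>t. t \<in> {1..T} \<Longrightarrow> V t \<le> 4 * \<eta>\<^sup>2 * d\<^sup>2 / \<alpha>\<^sup>2 *
      (4 * \<sigma>0\<^sup>2 + L0\<^sup>2 * V (t - 1) + 2 * \<alpha>\<^sup>2 * ((N t + \<sigma>1\<^sup>2) / d + (N (t - 1) + \<sigma>1\<^sup>2) / d) + L\<^sup>2 * \<alpha> ^ 4)"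
    and N: "\<And>t. t \<in> {1..T} \<Longrightarrow> N t \<le> 2 * L * (P t + L * \<alpha>\<^sup>2 / 2)" "\<And>t. 0 \<le> N t" "N 0 \<le> L0\<^sup>2"
    and R: "\<And>t. t \<in> {1..T} \<Longrightarrow> R (Suc t) \<le> R t - 2 * \<eta> * P t + V t" "\<And>t. 0 \<le> R t"
    and pos: "0 < \<eta>" "0 < \<alpha>" "1 \<le> d" "0 < L" "0 < L0" "1 \<le> T"
    and step: "\<eta> \<le> \<alpha> / (8 * d * L0)" "\<eta> \<le> 1 / (64 * d * L)"
  shows "(1 / real T) * (\<Sum>t=1..T. P t + L * \<alpha>\<^sup>2 / 2)
    \<le> R 1 / (\<eta> * real T) + 20 * \<eta> * d\<^sup>2 * L\<^sup>2 * \<alpha>\<^sup>2 + 16 * \<eta> * d * L0\<^sup>2 / real T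
      + L * \<alpha>\<^sup>2 / 2 + 128 * d\<^sup>2 * \<sigma>0\<^sup>2 * \<eta> / \<alpha>\<^sup>2 + 64 * d * \<eta> * \<sigma>1\<^sup>2"
proof -
  define SV SN SP where "SV = (\<Sum>t=1..T. V t)" and "SN = (\<Sum>t=1..T. N t)" and "SP = (\<Sum>t=1..T. P t)"
  \<comment> \<open>Shifting the index costs only the initial term: \<open>0\<close> for \<open>V\<close>, at most \<open>L0\<^sup>2\<close> for \<open>N\<close>.\<close>
  have shift: "(\<Sum>t=1..T. h (t - 1)) \<le> h 0 + (\<Sum>t=1..T. h t)" if "\<And>t. 0 \<le> h t" for h :: "nat \<Rightarrow> real"
  proof -
    have "(\<Sum>t=1..T. h (t - 1)) = (\<Sum>t=0..<T. h t)"
      by (rule sum.reindex_bij_witness[of _ Suc "\<lambda>t. t - 1"]) auto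
    also have "\<dots> \<le> (\<Sum>t=0..T. h t)"
      using that by (intro sum_mono2) auto
    finally show ?thesis
      by (simp add: sum.atLeast_Suc_atMost)
  qed
  define c where "c = 16 * \<eta>\<^sup>2 * d\<^sup>2 * \<sigma>0\<^sup>2 / \<alpha>\<^sup>2 + 16 * \<eta>\<^sup>2 * d * \<sigma>1\<^sup>2 + 4 * \<eta>\<^sup>2 * d\<^sup>2 * L\<^sup>2 * \<alpha>\<^sup>2"
  \<comment> \<open>This is where the first bound on the step size enters: \<open>4 / 8\<^sup>2 = 1 / 16\<close>.\<close>
  have contraction: "4 * \<eta>\<^sup>2 * d\<^sup>2 / \<alpha>\<^sup>2 * L0\<^sup>2 \<le> 1 / 16"
  proof -
    have "8 * (\<eta> * d * L0) \<le> \<alpha>"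
      using step(1) pos by (simp add: field_simps)
    then have "(8 * (\<eta> * d * L0))\<^sup>2 \<le> \<alpha>\<^sup>2"
      using pos by (intro power_mono) auto
    then have "(8 * (\<eta> * d * L0))\<^sup>2 / \<alpha>\<^sup>2 \<le> 1"
      using pos by simp
    then have "(8 * (\<eta> * d * L0))\<^sup>2 / \<alpha>\<^sup>2 / 16 \<le> 1 / 16"
      by (rule divide_right_mono) simp
    also have "(8 * (\<eta> * d * L0))\<^sup>2 / \<alpha>\<^sup>2 / 16 = 4 * \<eta>\<^sup>2 * d\<^sup>2 / \<alpha>\<^sup>2 * L0\<^sup>2"
      by (simp add: power_mult_distrib)
    finally show ?thesis .
  qed
  have "V t \<le> c + V (t - 1) / 16 + 8 * \<eta>\<^sup>2 * d * (N t + N (t - 1))" if "t \<in> {1..T}" for t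
  proof -
    define Q A A' where "Q = d\<^sup>2 / \<alpha>\<^sup>2" and "A = (N t + \<sigma>1\<^sup>2) / d" and "A' = (N (t - 1) + \<sigma>1\<^sup>2) / d"
    have Q: "4 * \<eta>\<^sup>2 * d\<^sup>2 / \<alpha>\<^sup>2 = 4 * \<eta>\<^sup>2 * Q"
      by (simp add: Q_def)
    have expand: "4 * \<eta>\<^sup>2 * Q * (4 * \<sigma>0\<^sup>2 + L0\<^sup>2 * V (t - 1) + 2 * \<alpha>\<^sup>2 * (A + A') + L\<^sup>2 * \<alpha> ^ 4)
        = 16 * \<eta>\<^sup>2 * (Q * \<sigma>0\<^sup>2) + 4 * \<eta>\<^sup>2 * Q * L0\<^sup>2 * V (t - 1)
          + 8 * \<eta>\<^sup>2 * (Q * \<alpha>\<^sup>2 * A) + 8 * \<eta>\<^sup>2 * (Q * \<alpha>\<^sup>2 * A') + 4 * \<eta>\<^sup>2 * L\<^sup>2 * (Q * \<alpha> ^ 4)"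
      by (simp only: distrib_left distrib_right mult_ac)
    have cancel: "Q * \<alpha>\<^sup>2 * A = d * (N t + \<sigma>1\<^sup>2)" "Q * \<alpha>\<^sup>2 * A' = d * (N (t - 1) + \<sigma>1\<^sup>2)"
      "Q * \<alpha> ^ 4 = d\<^sup>2 * \<alpha>\<^sup>2"
      using pos by (simp_all add: Q_def A_def A'_def power2_eq_square power4_eq_xxxx)
    have c: "c = 16 * \<eta>\<^sup>2 * (Q * \<sigma>0\<^sup>2) + 16 * \<eta>\<^sup>2 * d * \<sigma>1\<^sup>2 + 4 * \<eta>\<^sup>2 * L\<^sup>2 * (d\<^sup>2 * \<alpha>\<^sup>2)"
      by (simp add: c_def Q_def)
    have "4 * \<eta>\<^sup>2 * Q * (4 * \<sigma>0\<^sup>2 + L0\<^sup>2 * V (t - 1) + 2 * \<alpha>\<^sup>2 * (A + A') + L\<^sup>2 * \<alpha> ^ 4)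
        = c + (4 * \<eta>\<^sup>2 * d\<^sup>2 / \<alpha>\<^sup>2 * L0\<^sup>2) * V (t - 1) + 8 * \<eta>\<^sup>2 * d * (N t + N (t - 1))"
      unfolding Q expand cancel c by (simp add: algebra_simps)
    with V[OF that] have "V t \<le> c + (4 * \<eta>\<^sup>2 * d\<^sup>2 / \<alpha>\<^sup>2 * L0\<^sup>2) * V (t - 1) + 8 * \<eta>\<^sup>2 * d * (N t + N (t - 1))"
      unfolding Q A_def A'_def by simp
    with mult_right_mono[OF contraction V0(2)[of "t - 1"]] show ?thesis
      by simp
  qed
  then have "SV \<le> (\<Sum>t=1..T. c + V (t - 1) / 16 + 8 * \<eta>\<^sup>2 * d * (N t + N (t - 1)))"
    unfolding SV_def by (intro sum_mono) auto
  also have "\<dots> = real T * c + (\<Sum>t=1..T. V (t - 1)) / 16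
      + 8 * \<eta>\<^sup>2 * d * (SN + (\<Sum>t=1..T. N (t - 1)))"
    by (simp add: SN_def sum.distrib sum_distrib_left[symmetric] sum_divide_distrib[symmetric])
  also have "\<dots> \<le> real T * c + SV / 16 + 8 * \<eta>\<^sup>2 * d * (2 * SN + L0\<^sup>2)"
  proof -
    have "(\<Sum>t=1..T. V (t - 1)) \<le> SV"
      using shift[of V] V0 unfolding SV_def by simp
    moreover have "(\<Sum>t=1..T. N (t - 1)) \<le> L0\<^sup>2 + SN"
      using shift[of N] N unfolding SN_def by simp
    then have "8 * \<eta>\<^sup>2 * d * (SN + (\<Sum>t=1..T. N (t - 1))) \<le> 8 * \<eta>\<^sup>2 * d * (2 * SN + L0\<^sup>2)"
      using pos by (intro mult_left_mono) auto
    ultimately show ?thesis by simp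
  qed
  also have "\<dots> \<le> real T * c + SV / 16 + 8 * \<eta>\<^sup>2 * d * (4 * L * SP + 2 * L\<^sup>2 * \<alpha>\<^sup>2 * real T + L0\<^sup>2)"
  proof -
    have "SN \<le> (\<Sum>t=1..T. 2 * L * (P t + L * \<alpha>\<^sup>2 / 2))"
      unfolding SN_def using N(1) by (intro sum_mono) auto
    also have "\<dots> = 2 * L * SP + L\<^sup>2 * \<alpha>\<^sup>2 * real T"
      unfolding sum_distrib_left[symmetric] by (simp add: SP_def sum.distrib algebra_simps power2_eq_square)
    finally have "8 * \<eta>\<^sup>2 * d * (2 * SN + L0\<^sup>2) \<le> 8 * \<eta>\<^sup>2 * d * (4 * L * SP + 2 * L\<^sup>2 * \<alpha>\<^sup>2 * real T + L0\<^sup>2)"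
      using pos by (intro mult_left_mono) auto
    then show ?thesis by simp
  qed
  finally have SV_le: "15 / 16 * SV \<le> real T * c + 16 * \<eta>\<^sup>2 * d * L\<^sup>2 * \<alpha>\<^sup>2 * real T
      + 8 * \<eta>\<^sup>2 * d * L0\<^sup>2 + 32 * \<eta>\<^sup>2 * d * L * SP"
    by (simp add: algebra_simps)
  have SP_le: "2 * \<eta> * SP \<le> R 1 + SV"
  proof -
    have "(\<Sum>t=1..T. 2 * \<eta> * P t) \<le> (\<Sum>t=1..T. (R t - R (Suc t)) + V t)"
      using R(1) by (intro sum_mono) force
    also have "\<dots> = (R 1 - R (Suc T)) + SV"
      using sum_Suc_diff[of 1 T "\<lambda>t. - R t"] pos by (simp add: SV_def sum.distrib)
    finally show ?thesis
      using R(2)[of "Suc T"] by (simp add: SP_def sum_distrib_left)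
  qed
  define E where "E = real T * c + 16 * \<eta>\<^sup>2 * d * L\<^sup>2 * \<alpha>\<^sup>2 * real T + 8 * \<eta>\<^sup>2 * d * L0\<^sup>2"
  have "0 \<le> E"
    using pos by (simp add: E_def c_def)
  have "\<eta> * SP \<le> R 1 + E"
  proof (cases "SP \<le> 0")
    case True
    then have "\<eta> * SP \<le> 0"
      using pos by (simp add: mult_nonneg_nonpos)
    then show ?thesis
      using R(2)[of 1] \<open>0 \<le> E\<close> by linarith
  next
    case False
    \<comment> \<open>The second bound on the step size makes the coefficient of \<open>SP\<close> in the bound of \<open>SV\<close> absorbable.\<close>
    have "64 * \<eta> * d * L \<le> 1"
      using step(2) pos by (simp add: field_simps)
    then have "(64 * \<eta> * d * L) * (\<eta> * SP) \<le> 1 * (\<eta> * SP)"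
      using pos False by (intro mult_right_mono) auto
    then have "32 * \<eta>\<^sup>2 * d * L * SP \<le> \<eta> * SP / 2"
      by (simp add: power2_eq_square mult_ac)
    then show ?thesis
      using SV_le SP_le R(2)[of 1] \<open>0 \<le> E\<close> unfolding E_def by linarith
  qed
  then have "\<eta> * SP / (\<eta> * real T) \<le> (R 1 + E) / (\<eta> * real T)"
    using pos by (intro divide_right_mono) auto
  then have "SP / real T \<le> (R 1 + E) / (\<eta> * real T)"
    using pos by simp
  also have "(R 1 + E) / (\<eta> * real T)
      = R 1 / (\<eta> * real T) + (real T * c / (\<eta> * real T) + 16 * \<eta>\<^sup>2 * d * L\<^sup>2 * \<alpha>\<^sup>2 * real T / (\<eta> * real T))
        + 8 * \<eta>\<^sup>2 * d * L0\<^sup>2 / (\<eta> * real T)"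
    by (simp only: E_def add_divide_distrib add.assoc)
  also have "real T * c / (\<eta> * real T) = c / \<eta>"
    using pos by simp
  also have "16 * \<eta>\<^sup>2 * d * L\<^sup>2 * \<alpha>\<^sup>2 * real T / (\<eta> * real T) = 16 * \<eta> * d * L\<^sup>2 * \<alpha>\<^sup>2"
    using pos by (simp add: power2_eq_square[of \<eta>])
  also have "8 * \<eta>\<^sup>2 * d * L0\<^sup>2 / (\<eta> * real T) = 8 * \<eta> * d * L0\<^sup>2 / real T"
    using pos by (simp add: power2_eq_square[of \<eta>])
  also have "c / \<eta> = 16 * \<eta> * d\<^sup>2 * \<sigma>0\<^sup>2 / \<alpha>\<^sup>2 + 16 * \<eta> * d * \<sigma>1\<^sup>2 + 4 * \<eta> * d\<^sup>2 * L\<^sup>2 * \<alpha>\<^sup>2"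
    using pos unfolding c_def add_divide_distrib by (simp add: power2_eq_square[of \<eta>])
  finally have avg: "SP / real T \<le> R 1 / (\<eta> * real T) + (16 * \<eta> * d\<^sup>2 * \<sigma>0\<^sup>2 / \<alpha>\<^sup>2 + 16 * \<eta> * d * \<sigma>1\<^sup>2
      + 4 * \<eta> * d\<^sup>2 * L\<^sup>2 * \<alpha>\<^sup>2 + 16 * \<eta> * d * L\<^sup>2 * \<alpha>\<^sup>2) + 8 * \<eta> * d * L0\<^sup>2 / real T" .
  \<comment> \<open>As \<open>1 \<le> d\<close>, the two terms in \<open>L\<^sup>2 \<alpha>\<^sup>2\<close> combine to \<open>4 + 16 = 20\<close> times \<open>\<eta> d\<^sup>2 L\<^sup>2 \<alpha>\<^sup>2\<close>.\<close>
  have "d \<le> d\<^sup>2"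
    using pos by (simp add: power2_eq_square)
  then have "16 * \<eta> * d * L\<^sup>2 * \<alpha>\<^sup>2 \<le> 16 * \<eta> * d\<^sup>2 * L\<^sup>2 * \<alpha>\<^sup>2"
    using pos by (intro mult_right_mono mult_left_mono) auto
  moreover have "16 * \<eta> * d\<^sup>2 * \<sigma>0\<^sup>2 / \<alpha>\<^sup>2 \<le> 128 * d\<^sup>2 * \<sigma>0\<^sup>2 * \<eta> / \<alpha>\<^sup>2"
    using pos by (simp add: divide_right_mono)
  moreover have "16 * \<eta> * d * \<sigma>1\<^sup>2 \<le> 64 * d * \<eta> * \<sigma>1\<^sup>2"
    using pos by (simp add: mult_ac)
  moreover have "8 * \<eta> * d * L0\<^sup>2 / real T \<le> 16 * \<eta> * d * L0\<^sup>2 / real T"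
    using pos by (simp add: divide_right_mono)
  moreover have "(1 / real T) * (\<Sum>t=1..T. P t + L * \<alpha>\<^sup>2 / 2) = SP / real T + L * \<alpha>\<^sup>2 / 2"
    using pos by (simp add: SP_def sum.distrib add_divide_distrib)
  ultimately show ?thesis
    using avg by linarith
qed

section \<open>The residual feedback process\<close>

text \<open>One run of the algorithm, with the direction and the sample of each time combined in the pair \<open>W t\<close>.
The pairs at times \<open>0\<close> to \<open>T\<close> are independent with the law \<open>sample\<close>.\<close>

locale residual_feedback = stochastic_objective D F f L0 L \<sigma>0 \<sigma>1 xstar + M: prob_space M
  for D :: "'s measure" and F :: "'a::euclidean_space \<Rightarrow> 's \<Rightarrow> real" and f :: "'a \<Rightarrow> real"
    and L0 L \<sigma>0 \<sigma>1 :: real and xstar :: 'a and M :: "'w measure" +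
  fixes W :: "nat \<Rightarrow> 'w \<Rightarrow> 'a \<times> 's" and T :: nat and \<alpha> \<eta> :: real and x1 :: 'a
  assumes W_indep: "M.indep_vars (\<lambda>_. borel \<Otimes>\<^sub>M D) W {..T}"
    and W_law: "t \<le> T \<Longrightarrow> distr M (borel \<Otimes>\<^sub>M D) (W t) = sample"
    and \<alpha>_pos: "0 < \<alpha>" and \<eta>_pos: "0 < \<eta>"
begin

abbreviation u :: "nat \<Rightarrow> 'w \<Rightarrow> 'a" where "u t \<omega> \<equiv> fst (W t \<omega>)"
abbreviation \<xi> :: "nat \<Rightarrow> 'w \<Rightarrow> 's" where "\<xi> t \<omega> \<equiv> snd (W t \<omega>)"

definition X :: "nat \<Rightarrow> 'w \<Rightarrow> 'a" where
  "X t \<omega> = residual_iterate F \<alpha> \<eta> x1 (\<lambda>i. u i \<omega>) (\<lambda>i. \<xi> i \<omega>) t"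

definition query :: "nat \<Rightarrow> 'w \<Rightarrow> real" where
  "query t \<omega> = F (X t \<omega> + \<alpha> *\<^sub>R u t \<omega>) (\<xi> t \<omega>)"

text \<open>Measurability of \<open>Z\<close> with respect to the samples before time \<open>t\<close>, with an explicit factorization
through the tuple of these samples: that is the form in which independence of \<open>W t\<close> can be applied.\<close>

definition determined_before :: "nat \<Rightarrow> 'b measure \<Rightarrow> ('w \<Rightarrow> 'b) \<Rightarrow> bool" where
  "determined_before t N Z \<longleftrightarrow>
    (\<exists>\<phi> \<in> measurable (PiM {..<t} (\<lambda>_. borel \<Otimes>\<^sub>M D)) N. Z = (\<lambda>\<omega>. \<phi> (\<lambda>i\<in>{..<t}. W i \<omega>)))"

lemma W_measurable: "t \<le> T \<Longrightarrow> W t \<in> measurable M (borel \<Otimes>\<^sub>M D)"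
  using W_indep by (auto simp: M.indep_vars_def)

lemma \<xi>_measurable: "t \<le> T \<Longrightarrow> \<xi> t \<in> measurable M D"
  using measurable_compose[OF W_measurable measurable_snd] .

lemma determined_before_measurable:
  assumes "determined_before t N Z" "t \<le> Suc T"
  shows "Z \<in> measurable M N"
proof -
  have "(\<lambda>\<omega>. \<lambda>i\<in>{..<t}. W i \<omega>) \<in> measurable M (PiM {..<t} (\<lambda>_. borel \<Otimes>\<^sub>M D))"
    using assms(2) by (intro measurable_restrict W_measurable) auto
  with assms(1) show ?thesis
    unfolding determined_before_def by (auto intro: measurable_compose)
qed

lemma distr_determined_before:
  assumes "determined_before t N Z" "t \<le> T"
  shows "distr M (N \<Otimes>\<^sub>M (borel \<Otimes>\<^sub>M D)) (\<lambda>\<omega>. (Z \<omega>, W t \<omega>)) = distr M N Z \<Otimes>\<^sub>M sample"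
proof -
  obtain \<phi> where \<phi>: "\<phi> \<in> measurable (PiM {..<t} (\<lambda>_. borel \<Otimes>\<^sub>M D)) N"
    and Z: "Z = (\<lambda>\<omega>. \<phi> (\<lambda>i\<in>{..<t}. W i \<omega>))"
    using assms(1) unfolding determined_before_def by blast
  show ?thesis
    using M.distr_past_fresh[OF W_indep assms(2) \<phi>] W_law[OF assms(2)] unfolding Z by simp
qed

lemma determined_before_Pair:
  assumes "determined_before t N1 Z1" "determined_before t N2 Z2"
  shows "determined_before t (N1 \<Otimes>\<^sub>M N2) (\<lambda>\<omega>. (Z1 \<omega>, Z2 \<omega>))"
proof -
  from assms obtain \<phi>1 \<phi>2 where "\<phi>1 \<in> measurable (PiM {..<t} (\<lambda>_. borel \<Otimes>\<^sub>M D)) N1"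
    "Z1 = (\<lambda>\<omega>. \<phi>1 (\<lambda>i\<in>{..<t}. W i \<omega>))" "\<phi>2 \<in> measurable (PiM {..<t} (\<lambda>_. borel \<Otimes>\<^sub>M D)) N2"
    "Z2 = (\<lambda>\<omega>. \<phi>2 (\<lambda>i\<in>{..<t}. W i \<omega>))"
    unfolding determined_before_def by blast
  then show ?thesis
    unfolding determined_before_def by (intro bexI[of _ "\<lambda>p. (\<phi>1 p, \<phi>2 p)"]) auto
qed

lemma iterate_restrict:
  assumes "t \<le> m"
  shows "X t \<omega> = residual_iterate F \<alpha> \<eta> x1 (\<lambda>i. fst ((\<lambda>i\<in>{..<m}. W i \<omega>) i))
    (\<lambda>i. snd ((\<lambda>i\<in>{..<m}. W i \<omega>) i)) t"
  unfolding X_def by (rule residual_iterate_cong) (use assms in auto)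

lemma determined_before_X: "determined_before t borel (X t)"
  unfolding determined_before_def
  by (intro bexI[OF _ measurable_residual_iterate[of t "{..<t}" \<alpha> \<eta> x1]] ext iterate_restrict) auto

lemma determined_before_query:
  assumes "i < t"
  shows "determined_before t borel (query i)"
  unfolding determined_before_def
proof (rule bexI)
  let ?\<phi> = "\<lambda>p. F (residual_iterate F \<alpha> \<eta> x1 (\<lambda>i. fst (p i)) (\<lambda>i. snd (p i)) i + \<alpha> *\<^sub>R fst (p i)) (snd (p i))"
  show "query i = (\<lambda>\<omega>. ?\<phi> (\<lambda>i\<in>{..<t}. W i \<omega>))"
    using assms by (simp add: fun_eq_iff query_def iterate_restrict[of i t])
  have "{..<i} \<subseteq> {..<t}" "i \<in> {..<t}"
    using assms by auto
  note [measurable] = measurable_residual_iterate[OF this(1), of \<alpha> \<eta> x1]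
    measurable_component_singleton[OF this(2), of "\<lambda>_. borel \<Otimes>\<^sub>M D"]
  show "?\<phi> \<in> borel_measurable (PiM {..<t} (\<lambda>_. borel \<Otimes>\<^sub>M D))"
    by measurable
qed

lemma X_measurable: "t \<le> Suc T \<Longrightarrow> X t \<in> borel_measurable M"
  by (rule determined_before_measurable[OF determined_before_X])

lemma prob_space_sample: "prob_space sample"
proof -
  interpret pair_prob_space "uniform_unit_sphere :: 'a measure" D
    by (rule pair_prob_space_sample)
  show ?thesis by (rule prob_space_axioms)
qed

lemma AE_norm_u:
  assumes "t \<le> T"
  shows "AE \<omega> in M. norm (u t \<omega>) = 1"
proof -
  interpret P: pair_prob_space "uniform_unit_sphere :: 'a measure" D
    by (rule pair_prob_space_sample)
  have "AE p in sample. norm (fst p) = 1"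
  proof (rule P.AE_pair_measure)
    show "AE u in uniform_unit_sphere. AE s in D. norm (fst (u, s)) = 1"
      using AE_uniform_unit_sphere by eventually_elim simp
  qed measurable
  then have "AE p in distr M (borel \<Otimes>\<^sub>M D) (W t). norm (fst p) = 1"
    unfolding W_law[OF assms] .
  then show ?thesis
    using W_measurable[OF assms] by (subst (asm) AE_distr_iff) auto
qed

definition noise :: "nat \<Rightarrow> 'w \<Rightarrow> real" where
  "noise t \<omega> = F (X t \<omega>) (\<xi> t \<omega>) - f (X t \<omega>)"

definition slope :: "nat \<Rightarrow> 'w \<Rightarrow> real" where
  "slope t \<omega> = gradF (X t \<omega>) (\<xi> t \<omega>) \<bullet> u t \<omega>"

lemma gradf_square_integrable: "t \<le> Suc T \<Longrightarrow> integrable M (\<lambda>\<omega>. (norm (gradf (X t \<omega>)))\<^sup>2)"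
  using X_measurable[of t] norm_gradf_le
  by (intro M.integrable_const_bound[where B = "L0\<^sup>2"]) (auto intro!: power_mono)

lemma noise_second_moment:
  assumes "t \<le> T"
  shows "integrable M (\<lambda>\<omega>. (noise t \<omega>)\<^sup>2)"
    and "(\<integral>\<omega>. (noise t \<omega>)\<^sup>2 \<partial>M) \<le> \<sigma>0\<^sup>2"
proof -
  have "integrable M (\<lambda>\<omega>. (\<lambda>p. (F (fst p) (snd (snd p)) - f (fst p))\<^sup>2) (X t \<omega>, W t \<omega>)) \<and>
    (\<integral>\<omega>. (\<lambda>p. (F (fst p) (snd (snd p)) - f (fst p))\<^sup>2) (X t \<omega>, W t \<omega>) \<partial>M) \<le> (\<integral>\<omega>. (\<lambda>_. \<sigma>0\<^sup>2) (X t \<omega>) \<partial>M)"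
  proof (rule M.integral_le_if_indep[OF distr_determined_before[OF determined_before_X assms] prob_space_sample])
    show "X t \<in> borel_measurable M" "W t \<in> measurable M (borel \<Otimes>\<^sub>M D)"
      using assms by (auto intro: X_measurable W_measurable)
    show "sets sample = sets (borel \<Otimes>\<^sub>M D)"
      by (simp cong: sets_pair_measure_cong)
    show "(\<integral>\<^sup>+q. ennreal ((\<lambda>p. (F (fst p) (snd (snd p)) - f (fst p))\<^sup>2) (z, q)) \<partial>sample) \<le> ennreal ((\<lambda>_. \<sigma>0\<^sup>2) z)" for z
      using sample_value_noise[of z] by simp
  qed auto
  then show "integrable M (\<lambda>\<omega>. (noise t \<omega>)\<^sup>2)"
    "(\<integral>\<omega>. (noise t \<omega>)\<^sup>2 \<partial>M) \<le> \<sigma>0\<^sup>2"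
    by (simp_all add: noise_def M.prob_space)
qed

lemma slope_second_moment:
  assumes "t \<le> T"
  shows "integrable M (\<lambda>\<omega>. (slope t \<omega>)\<^sup>2)"
    and "(\<integral>\<omega>. (slope t \<omega>)\<^sup>2 \<partial>M) \<le> ((\<integral>\<omega>. (norm (gradf (X t \<omega>)))\<^sup>2 \<partial>M) + \<sigma>1\<^sup>2) / real DIM('a)"
proof -
  have "integrable M (\<lambda>\<omega>. (\<lambda>p. (gradF (fst p) (snd (snd p)) \<bullet> fst (snd p))\<^sup>2) (X t \<omega>, W t \<omega>)) \<and>
    (\<integral>\<omega>. (\<lambda>p. (gradF (fst p) (snd (snd p)) \<bullet> fst (snd p))\<^sup>2) (X t \<omega>, W t \<omega>) \<partial>M) \<le> (\<integral>\<omega>. (\<lambda>z. ((norm (gradf z))\<^sup>2 + \<sigma>1\<^sup>2) / real DIM('a)) (X t \<omega>) \<partial>M)"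
  proof (rule M.integral_le_if_indep[OF distr_determined_before[OF determined_before_X assms] prob_space_sample])
    show "X t \<in> borel_measurable M" "W t \<in> measurable M (borel \<Otimes>\<^sub>M D)"
      using assms by (auto intro: X_measurable W_measurable)
    show "sets sample = sets (borel \<Otimes>\<^sub>M D)"
      by (simp cong: sets_pair_measure_cong)
    show "(\<integral>\<^sup>+q. ennreal ((\<lambda>p. (gradF (fst p) (snd (snd p)) \<bullet> fst (snd p))\<^sup>2) (z, q)) \<partial>sample) \<le> ennreal ((\<lambda>z. ((norm (gradf z))\<^sup>2 + \<sigma>1\<^sup>2) / real DIM('a)) z)" for z
      using sample_directional_derivative[of z] by simp
  qed (use gradf_square_integrable[of t] assms in auto)
  then show "integrable M (\<lambda>\<omega>. (slope t \<omega>)\<^sup>2)"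
    "(\<integral>\<omega>. (slope t \<omega>)\<^sup>2 \<partial>M) \<le> ((\<integral>\<omega>. (norm (gradf (X t \<omega>)))\<^sup>2 \<partial>M) + \<sigma>1\<^sup>2) / real DIM('a)"
    using gradf_square_integrable[of t] assms by (simp_all add: slope_def M.prob_space)
qed

text \<open>The first-order expansion of the sampled function at \<open>X t\<close> in the direction \<open>\<alpha> u t\<close>, with
\<open>norm (u t) = 1\<close> almost surely.\<close>

lemma query_expansion:
  assumes "t \<le> T"
  shows "AE \<omega> in M. \<bar>query t \<omega> - (f (X t \<omega>) + noise t \<omega> + \<alpha> * slope t \<omega>)\<bar> \<le> L * \<alpha>\<^sup>2 / 2"
  using AE_norm_u[OF assms] AE_space
proof eventually_elim
  case (elim \<omega>)
  have "\<xi> t \<omega> \<in> space D"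
    using measurable_space[OF \<xi>_measurable[OF assms]] elim(2) by simp
  from smooth_with_quadratic_remainder[OF F_smooth[OF this], of "X t \<omega>" "\<alpha> *\<^sub>R u t \<omega>"]
  show ?case
    using elim(1) by (simp add: query_def noise_def slope_def inner_commute power_mult_distrib algebra_simps)
qed

lemma X_0 [simp]: "X 0 \<omega> = x1" and X_1 [simp]: "X (Suc 0) \<omega> = x1"
  by (simp_all add: X_def)

lemma X_Suc:
  assumes "1 \<le> t"
  shows "X (Suc t) \<omega> = X t \<omega> - (\<eta> * (real DIM('a) / \<alpha>) * (query t \<omega> - query (t - 1) \<omega>)) *\<^sub>R u t \<omega>"
proof -
  obtain n where "t = Suc n"
    using assms by (cases t) auto
  then show ?thesis
    by (simp add: X_def query_def residual_estimate_def mult_ac)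
qed

text \<open>The change of \<open>f\<close> between the last two iterates is bounded through the Lipschitz constant by the
previous increment. For \<open>t = 1\<close> that increment is \<open>0\<close>, as \<open>X 0 = X 1\<close>.\<close>

lemma increment_bound:
  assumes "1 \<le> t" "t \<le> T"
  defines "B \<omega> \<equiv> 2 * (noise t \<omega>)\<^sup>2 + 2 * (noise (t - 1) \<omega>)\<^sup>2
      + L0\<^sup>2 * (norm (X (Suc (t - 1)) \<omega> - X (t - 1) \<omega>))\<^sup>2
      + 2 * \<alpha>\<^sup>2 * ((slope t \<omega>)\<^sup>2 + (slope (t - 1) \<omega>)\<^sup>2) + L\<^sup>2 * \<alpha> ^ 4"
  shows "AE \<omega> in M. (norm (X (Suc t) \<omega> - X t \<omega>))\<^sup>2 \<le> 4 * \<eta>\<^sup>2 * (real DIM('a))\<^sup>2 / \<alpha>\<^sup>2 * B \<omega>"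
  using AE_norm_u[OF assms(2)] query_expansion[OF assms(2)] query_expansion[OF diff_le_self[THEN order_trans, OF assms(2)], of 1]
proof eventually_elim
  case (elim \<omega>)
  have "(f (X t \<omega>) - f (X (t - 1) \<omega>))\<^sup>2 \<le> (L0 * norm (X t \<omega> - X (t - 1) \<omega>))\<^sup>2"
    using lipschitz_onD[OF f_lipschitz, of "X t \<omega>" "X (t - 1) \<omega>"] by (intro power2_mono) (simp add: dist_norm)
  then have fX: "(f (X t \<omega>) - f (X (t - 1) \<omega>))\<^sup>2 \<le> L0\<^sup>2 * (norm (X (Suc (t - 1)) \<omega> - X (t - 1) \<omega>))\<^sup>2"
    using assms by (simp add: power_mult_distrib)
  have "4 * (L * \<alpha>\<^sup>2 / 2)\<^sup>2 = L\<^sup>2 * \<alpha> ^ 4"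
    by (simp add: power_mult_distrib power_divide flip: power_mult)
  with residual_difference_sq_le[OF elim(2,3)]
  have "(query t \<omega> - query (t - 1) \<omega>)\<^sup>2 \<le> 4 * (2 * (noise t \<omega>)\<^sup>2 + 2 * (noise (t - 1) \<omega>)\<^sup>2
      + (f (X t \<omega>) - f (X (t - 1) \<omega>))\<^sup>2
      + 2 * \<alpha>\<^sup>2 * ((slope t \<omega>)\<^sup>2 + (slope (t - 1) \<omega>)\<^sup>2) + L\<^sup>2 * \<alpha> ^ 4)"
    by (simp only:)
  also have "\<dots> \<le> 4 * (2 * (noise t \<omega>)\<^sup>2 + 2 * (noise (t - 1) \<omega>)\<^sup>2
      + L0\<^sup>2 * (norm (X (Suc (t - 1)) \<omega> - X (t - 1) \<omega>))\<^sup>2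
      + 2 * \<alpha>\<^sup>2 * ((slope t \<omega>)\<^sup>2 + (slope (t - 1) \<omega>)\<^sup>2) + L\<^sup>2 * \<alpha> ^ 4)"
    using fX by (intro mult_left_mono add_mono order_refl) auto
  finally have query_le: "(query t \<omega> - query (t - 1) \<omega>)\<^sup>2 \<le> 4 * B \<omega>"
    unfolding B_def .
  have "(norm (X (Suc t) \<omega> - X t \<omega>))\<^sup>2 = (\<eta> * (real DIM('a) / \<alpha>))\<^sup>2 * (query t \<omega> - query (t - 1) \<omega>)\<^sup>2"
    using elim(1) by (simp add: X_Suc[OF assms(1)] power_mult_distrib power_divide)
  also have "\<dots> \<le> (\<eta> * (real DIM('a) / \<alpha>))\<^sup>2 * (4 * B \<omega>)"
    by (rule mult_left_mono[OF query_le]) simp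
  also have "\<dots> = 4 * \<eta>\<^sup>2 * (real DIM('a))\<^sup>2 / \<alpha>\<^sup>2 * B \<omega>"
    by (simp add: power_mult_distrib power_divide)
  finally show ?case .
qed

text \<open>Noise and slope have moments bounded uniformly in the position of the iterate. So the
increments are square integrable by induction, and only then the iterates themselves.\<close>

lemma increment_square_integrable:
  "t \<le> T \<Longrightarrow> integrable M (\<lambda>\<omega>. (norm (X (Suc t) \<omega> - X t \<omega>))\<^sup>2)"
proof (induction t)
  case (Suc t)
  show ?case
  proof (rule Bochner_Integration.integrable_bound)
    let ?B = "\<lambda>\<omega>. 4 * \<eta>\<^sup>2 * (real DIM('a))\<^sup>2 / \<alpha>\<^sup>2 *
      (2 * (noise (Suc t) \<omega>)\<^sup>2 + 2 * (noise t \<omega>)\<^sup>2 + L0\<^sup>2 * (norm (X (Suc t) \<omega> - X t \<omega>))\<^sup>2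
        + 2 * \<alpha>\<^sup>2 * ((slope (Suc t) \<omega>)\<^sup>2 + (slope t \<omega>)\<^sup>2) + L\<^sup>2 * \<alpha> ^ 4)"
    show "integrable M ?B"
      using Suc noise_second_moment(1) slope_second_moment(1) by simp
    show "AE \<omega> in M. norm ((norm (X (Suc (Suc t)) \<omega> - X (Suc t) \<omega>))\<^sup>2) \<le> norm (?B \<omega>)"
      using increment_bound[of "Suc t"] Suc.prems by (auto elim: eventually_mono)
    have [measurable]: "X (Suc t) \<in> borel_measurable M" "X (Suc (Suc t)) \<in> borel_measurable M"
      using Suc.prems by (auto intro: X_measurable)
    show "(\<lambda>\<omega>. (norm (X (Suc (Suc t)) \<omega> - X (Suc t) \<omega>))\<^sup>2) \<in> borel_measurable M"
      by measurable
  qed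
qed simp

lemma increment_second_moment:
  assumes "1 \<le> t" "t \<le> T"
  shows "(\<integral>\<omega>. (norm (X (Suc t) \<omega> - X t \<omega>))\<^sup>2 \<partial>M) \<le> 4 * \<eta>\<^sup>2 * (real DIM('a))\<^sup>2 / \<alpha>\<^sup>2 *
    (4 * \<sigma>0\<^sup>2 + L0\<^sup>2 * (\<integral>\<omega>. (norm (X (Suc (t - 1)) \<omega> - X (t - 1) \<omega>))\<^sup>2 \<partial>M)
      + 2 * \<alpha>\<^sup>2 * (((\<integral>\<omega>. (norm (gradf (X t \<omega>)))\<^sup>2 \<partial>M) + \<sigma>1\<^sup>2) / real DIM('a)
        + ((\<integral>\<omega>. (norm (gradf (X (t - 1) \<omega>)))\<^sup>2 \<partial>M) + \<sigma>1\<^sup>2) / real DIM('a)) + L\<^sup>2 * \<alpha> ^ 4)"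
proof -
  have t1: "t - 1 \<le> T" using assms by simp
  note int = noise_second_moment(1)[OF assms(2)] noise_second_moment(1)[OF t1]
    slope_second_moment(1)[OF assms(2)] slope_second_moment(1)[OF t1] increment_square_integrable[OF t1]
  have "(\<integral>\<omega>. (norm (X (Suc t) \<omega> - X t \<omega>))\<^sup>2 \<partial>M) \<le> (\<integral>\<omega>. 4 * \<eta>\<^sup>2 * (real DIM('a))\<^sup>2 / \<alpha>\<^sup>2 *
    (2 * (noise t \<omega>)\<^sup>2 + 2 * (noise (t - 1) \<omega>)\<^sup>2 + L0\<^sup>2 * (norm (X (Suc (t - 1)) \<omega> - X (t - 1) \<omega>))\<^sup>2
      + 2 * \<alpha>\<^sup>2 * ((slope t \<omega>)\<^sup>2 + (slope (t - 1) \<omega>)\<^sup>2) + L\<^sup>2 * \<alpha> ^ 4) \<partial>M)"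
    using int by (intro integral_mono_AE increment_square_integrable[OF assms(2)] increment_bound assms) auto
  also have "\<dots> = 4 * \<eta>\<^sup>2 * (real DIM('a))\<^sup>2 / \<alpha>\<^sup>2 *
    (2 * (\<integral>\<omega>. (noise t \<omega>)\<^sup>2 \<partial>M) + 2 * (\<integral>\<omega>. (noise (t - 1) \<omega>)\<^sup>2 \<partial>M)
      + L0\<^sup>2 * (\<integral>\<omega>. (norm (X (Suc (t - 1)) \<omega> - X (t - 1) \<omega>))\<^sup>2 \<partial>M)
      + 2 * \<alpha>\<^sup>2 * ((\<integral>\<omega>. (slope t \<omega>)\<^sup>2 \<partial>M) + (\<integral>\<omega>. (slope (t - 1) \<omega>)\<^sup>2 \<partial>M)) + L\<^sup>2 * \<alpha> ^ 4)"
    using int by (simp add: M.prob_space)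
  also have "\<dots> \<le> 4 * \<eta>\<^sup>2 * (real DIM('a))\<^sup>2 / \<alpha>\<^sup>2 *
    (2 * \<sigma>0\<^sup>2 + 2 * \<sigma>0\<^sup>2 + L0\<^sup>2 * (\<integral>\<omega>. (norm (X (Suc (t - 1)) \<omega> - X (t - 1) \<omega>))\<^sup>2 \<partial>M)
      + 2 * \<alpha>\<^sup>2 * (((\<integral>\<omega>. (norm (gradf (X t \<omega>)))\<^sup>2 \<partial>M) + \<sigma>1\<^sup>2) / real DIM('a)
        + ((\<integral>\<omega>. (norm (gradf (X (t - 1) \<omega>)))\<^sup>2 \<partial>M) + \<sigma>1\<^sup>2) / real DIM('a)) + L\<^sup>2 * \<alpha> ^ 4)"
    using noise_second_moment(2)[OF assms(2)] noise_second_moment(2)[OF t1]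
      slope_second_moment(2)[OF assms(2)] slope_second_moment(2)[OF t1]
    by (intro mult_left_mono add_mono order_refl) auto
  finally show ?thesis
    by simp
qed

lemma distance_square_integrable:
  "t \<le> Suc T \<Longrightarrow> integrable M (\<lambda>\<omega>. (norm (X t \<omega> - xstar))\<^sup>2)"
proof (induction t)
  case (Suc t)
  show ?case
  proof (rule Bochner_Integration.integrable_bound)
    show "integrable M (\<lambda>\<omega>. 2 * (norm (X (Suc t) \<omega> - X t \<omega>))\<^sup>2 + 2 * (norm (X t \<omega> - xstar))\<^sup>2)"
      using Suc increment_square_integrable[of t] by simp
    have "(norm (a + b))\<^sup>2 \<le> 2 * (norm a)\<^sup>2 + 2 * (norm b)\<^sup>2" for a b :: 'a
      using zero_le_power2[of "norm (a - b)"]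
      by (simp add: power2_norm_eq_inner inner_add_left inner_add_right inner_diff_left inner_diff_right
          inner_commute del: zero_le_power2)
    from this[of "X (Suc t) \<omega> - X t \<omega>" "X t \<omega> - xstar" for \<omega>]
    show "AE \<omega> in M. norm ((norm (X (Suc t) \<omega> - xstar))\<^sup>2)
        \<le> norm (2 * (norm (X (Suc t) \<omega> - X t \<omega>))\<^sup>2 + 2 * (norm (X t \<omega> - xstar))\<^sup>2)"
      by simp
    have [measurable]: "X (Suc t) \<in> borel_measurable M"
      using Suc.prems by (rule X_measurable)
    show "(\<lambda>\<omega>. (norm (X (Suc t) \<omega> - xstar))\<^sup>2) \<in> borel_measurable M"
      by measurable
  qed
qed simp

lemma integrable_gap:
  assumes "t \<le> Suc T"
  shows "integrable M (\<lambda>\<omega>. f (X t \<omega>) - f xstar)"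
proof (rule Bochner_Integration.integrable_bound)
  have [measurable]: "X t \<in> borel_measurable M"
    using assms by (rule X_measurable)
  have "integrable M (\<lambda>\<omega>. X t \<omega> - xstar)"
    using distance_square_integrable[OF assms] by (rule M.integrable_if_square_integrable[rotated]) measurable
  then show "integrable M (\<lambda>\<omega>. L0 * norm (X t \<omega> - xstar))"
    by simp
  show "AE \<omega> in M. norm (f (X t \<omega>) - f xstar) \<le> norm (L0 * norm (X t \<omega> - xstar))"
    using lipschitz_onD[OF f_lipschitz, of _ xstar] lipschitz_on_nonneg[OF f_lipschitz]
    by (simp add: dist_norm)
  show "(\<lambda>\<omega>. f (X t \<omega>) - f xstar) \<in> borel_measurable M"
    by measurable
qed

lemma gradf_moment_le_gap:
  assumes "t \<le> Suc T"
  shows "(\<integral>\<omega>. (norm (gradf (X t \<omega>)))\<^sup>2 \<partial>M) \<le> 2 * L * (\<integral>\<omega>. f (X t \<omega>) - f xstar \<partial>M)"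
proof -
  have "(\<integral>\<omega>. (norm (gradf (X t \<omega>)))\<^sup>2 \<partial>M) \<le> (\<integral>\<omega>. 2 * L * (f (X t \<omega>) - f xstar) \<partial>M)"
    using integrable_gap[OF assms] gradf_square_integrable[OF assms] norm_gradf_sq_le_gap
    by (intro integral_mono) auto
  then show ?thesis
    by simp
qed

text \<open>The position \<open>X t\<close> and the previous observation are determined before time \<open>t\<close>, so \<open>sample_descent\<close>
applies with both of them fixed.\<close>

lemma expected_descent:
  assumes "1 \<le> t" "t \<le> T"
  shows "(\<integral>\<omega>. (norm (X (Suc t) \<omega> - xstar))\<^sup>2 \<partial>M) \<le> (\<integral>\<omega>. (norm (X t \<omega> - xstar))\<^sup>2 \<partial>M)
    - 2 * \<eta> * ((\<integral>\<omega>. f (X t \<omega>) - f xstar \<partial>M) - L * \<alpha>\<^sup>2 / 2) + (\<integral>\<omega>. (norm (X (Suc t) \<omega> - X t \<omega>))\<^sup>2 \<partial>M)"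
proof -
  define K where "K p = real DIM('a) / \<alpha> *
    ((F (fst (fst p) + \<alpha> *\<^sub>R fst (snd p)) (snd (snd p)) - snd (fst p)) * ((fst (fst p) - xstar) \<bullet> fst (snd p)))"
    for p :: "('a \<times> real) \<times> ('a \<times> 's)"
  define Z where "Z \<omega> = (X t \<omega>, query (t - 1) \<omega>)" for \<omega>
  have Z: "determined_before t (borel \<Otimes>\<^sub>M borel) Z"
    unfolding Z_def[abs_def]
    by (rule determined_before_Pair[OF determined_before_X determined_before_query]) (use assms in simp)
  have Xm [measurable]: "X t \<in> borel_measurable M" "X (Suc t) \<in> borel_measurable M"
    using assms by (auto intro: X_measurable)
  have int: "integrable M (\<lambda>\<omega>. (norm (X (Suc t) \<omega> - X t \<omega>))\<^sup>2)" "integrable M (\<lambda>\<omega>. (norm (X t \<omega> - xstar))\<^sup>2)"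
    using assms by (auto intro: increment_square_integrable distance_square_integrable)
  have KZ: "(X (Suc t) \<omega> - X t \<omega>) \<bullet> (X t \<omega> - xstar) = - \<eta> * K (Z \<omega>, W t \<omega>)" for \<omega>
    by (simp add: X_Suc[OF assms(1)] K_def Z_def query_def inner_commute mult_ac)
  have int_inner: "integrable M (\<lambda>\<omega>. (X (Suc t) \<omega> - X t \<omega>) \<bullet> (X t \<omega> - xstar))"
  proof (rule Bochner_Integration.integrable_bound)
    show "integrable M (\<lambda>\<omega>. (norm (X (Suc t) \<omega> - X t \<omega>))\<^sup>2 + (norm (X t \<omega> - xstar))\<^sup>2)"
      using int by simp
    have "\<bar>a \<bullet> b\<bar> \<le> (norm a)\<^sup>2 + (norm b)\<^sup>2" for a b :: 'a
      using Cauchy_Schwarz_ineq2[of a b] sum_squares_bound[of "norm a" "norm b"]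
        mult_nonneg_nonneg[OF norm_ge_zero[of a] norm_ge_zero[of b]] by linarith
    then show "AE \<omega> in M. norm ((X (Suc t) \<omega> - X t \<omega>) \<bullet> (X t \<omega> - xstar))
        \<le> norm ((norm (X (Suc t) \<omega> - X t \<omega>))\<^sup>2 + (norm (X t \<omega> - xstar))\<^sup>2)"
      by simp
  qed measurable
  then have int_K: "integrable M (\<lambda>\<omega>. K (Z \<omega>, W t \<omega>))"
    unfolding KZ using \<eta>_pos by simp
  have "(\<integral>\<omega>. (\<lambda>z. f (fst z) - f xstar - L * \<alpha>\<^sup>2 / 2) (Z \<omega>) \<partial>M) \<le> (\<integral>\<omega>. K (Z \<omega>, W t \<omega>) \<partial>M)"
  proof (rule M.integral_ge_if_indep[OF distr_determined_before[OF Z assms(2)] prob_space_sample])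
    show "Z \<in> measurable M (borel \<Otimes>\<^sub>M borel)"
      by (rule determined_before_measurable[OF Z]) (use assms in simp)
    show "W t \<in> measurable M (borel \<Otimes>\<^sub>M D)"
      by (rule W_measurable) fact
    show "K \<in> borel_measurable ((borel \<Otimes>\<^sub>M borel) \<Otimes>\<^sub>M (borel \<Otimes>\<^sub>M D))"
      unfolding K_def[abs_def] by measurable
    show "sets sample = sets (borel \<Otimes>\<^sub>M D)"
      by (simp cong: sets_pair_measure_cong)
    show "integrable M (\<lambda>\<omega>. f (fst (Z \<omega>)) - f xstar - L * \<alpha>\<^sup>2 / 2)"
      using integrable_gap[of t] assms by (simp add: Z_def)
    show "f (fst z) - f xstar - L * \<alpha>\<^sup>2 / 2 \<le> (\<integral>q. K (z, q) \<partial>sample)" for z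
      using sample_descent[OF \<alpha>_pos, of "fst z" "snd z"] by (simp add: K_def)
  qed (use int_K in auto)
  then have lower: "(\<integral>\<omega>. f (X t \<omega>) - f xstar \<partial>M) - L * \<alpha>\<^sup>2 / 2 \<le> (\<integral>\<omega>. K (Z \<omega>, W t \<omega>) \<partial>M)"
    using integrable_gap[of t] assms by (simp add: Z_def M.prob_space)
  have "(norm (X (Suc t) \<omega> - xstar))\<^sup>2 = (norm (X t \<omega> - xstar))\<^sup>2
      + 2 * ((X (Suc t) \<omega> - X t \<omega>) \<bullet> (X t \<omega> - xstar)) + (norm (X (Suc t) \<omega> - X t \<omega>))\<^sup>2" for \<omega>
    by (simp add: power2_norm_eq_inner inner_diff_left inner_diff_right inner_commute)
  then have "(\<integral>\<omega>. (norm (X (Suc t) \<omega> - xstar))\<^sup>2 \<partial>M) = (\<integral>\<omega>. (norm (X t \<omega> - xstar))\<^sup>2 \<partial>M)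
      - 2 * \<eta> * (\<integral>\<omega>. K (Z \<omega>, W t \<omega>) \<partial>M) + (\<integral>\<omega>. (norm (X (Suc t) \<omega> - X t \<omega>))\<^sup>2 \<partial>M)"
    unfolding KZ using int int_K by simp
  with mult_left_mono[OF lower, of "2 * \<eta>"] \<eta>_pos show ?thesis
    by simp
qed

lemma average_gap_bound:
  assumes "1 \<le> T" "0 < L0" and step: "\<eta> \<le> min (\<alpha> / (8 * real DIM('a) * L0)) (1 / (64 * real DIM('a) * L))"
  shows "(1 / real T) * (\<Sum>t=1..T. (\<integral>\<omega>. f (X t \<omega>) - f xstar \<partial>M))
      \<le> (norm (x1 - xstar))\<^sup>2 / (\<eta> * real T) + 20 * \<eta> * (real DIM('a))\<^sup>2 * L\<^sup>2 * \<alpha>\<^sup>2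
        + 16 * \<eta> * real DIM('a) * L0\<^sup>2 / real T + L * \<alpha>\<^sup>2 / 2
        + 128 * (real DIM('a))\<^sup>2 * \<sigma>0\<^sup>2 * \<eta> / \<alpha>\<^sup>2 + 64 * real DIM('a) * \<eta> * \<sigma>1\<^sup>2"
proof -
  define V where "V t = (\<integral>\<omega>. (norm (X (Suc t) \<omega> - X t \<omega>))\<^sup>2 \<partial>M)" for t
  define N where "N t = (\<integral>\<omega>. (norm (gradf (X t \<omega>)))\<^sup>2 \<partial>M)" for t
  define P where "P t = (\<integral>\<omega>. f (X t \<omega>) - f xstar \<partial>M) - L * \<alpha>\<^sup>2 / 2" for t
  define R where "R t = (\<integral>\<omega>. (norm (X t \<omega> - xstar))\<^sup>2 \<partial>M)" for t
  have "(1 / real T) * (\<Sum>t=1..T. P t + L * \<alpha>\<^sup>2 / 2)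
    \<le> R 1 / (\<eta> * real T) + 20 * \<eta> * (real DIM('a))\<^sup>2 * L\<^sup>2 * \<alpha>\<^sup>2 + 16 * \<eta> * real DIM('a) * L0\<^sup>2 / real T
      + L * \<alpha>\<^sup>2 / 2 + 128 * (real DIM('a))\<^sup>2 * \<sigma>0\<^sup>2 * \<eta> / \<alpha>\<^sup>2 + 64 * real DIM('a) * \<eta> * \<sigma>1\<^sup>2"
  proof (rule summed_descent_bound)
    show "V t \<le> 4 * \<eta>\<^sup>2 * (real DIM('a))\<^sup>2 / \<alpha>\<^sup>2 * (4 * \<sigma>0\<^sup>2 + L0\<^sup>2 * V (t - 1)
        + 2 * \<alpha>\<^sup>2 * ((N t + \<sigma>1\<^sup>2) / real DIM('a) + (N (t - 1) + \<sigma>1\<^sup>2) / real DIM('a)) + L\<^sup>2 * \<alpha> ^ 4)"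
      if "t \<in> {1..T}" for t
      unfolding V_def N_def using that by (intro increment_second_moment) auto
    show "N t \<le> 2 * L * (P t + L * \<alpha>\<^sup>2 / 2)" if "t \<in> {1..T}" for t
      unfolding N_def P_def using gradf_moment_le_gap[of t] that by simp
    show "N 0 \<le> L0\<^sup>2"
      unfolding N_def using norm_gradf_le[of x1] by (simp add: M.prob_space power_mono)
    show "R (Suc t) \<le> R t - 2 * \<eta> * P t + V t" if "t \<in> {1..T}" for t
      unfolding R_def P_def V_def using that by (intro expected_descent) auto
  qed (use assms \<eta>_pos \<alpha>_pos L_pos in \<open>auto simp: V_def N_def R_def Suc_le_eq\<close>)
  then show ?thesis
    by (simp add: P_def R_def M.prob_space)
qed

end

section \<open>Convergence of the residual feedback algorithm\<close>

theorem theorem15: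
  fixes D :: "'s measure"
    and F :: "'a::euclidean_space \<Rightarrow> 's \<Rightarrow> real"
    and f :: "'a \<Rightarrow> real"
    and M :: "'w measure"
    and u :: "nat \<Rightarrow> 'w \<Rightarrow> 'a"
    and \<xi> :: "nat \<Rightarrow> 'w \<Rightarrow> 's"
    and x :: "nat \<Rightarrow> 'w \<Rightarrow> 'a"
    and x1 xstar :: 'a
    and L0 L \<sigma>0 \<sigma>1 \<alpha> \<eta> :: real
    and T :: nat
  assumes "prob_space D"
    and "\<And>y. integrable D (\<lambda>s. F y s)"
    and "\<And>y. f y = (\<integral>s. F y s \<partial>D)"
    and "L0 > 0" and "L > 0" and "\<sigma>0 > 0" and "\<sigma>1 > 0"
    and "convex_on UNIV f"
    and "L0-lipschitz_on UNIV f"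
    and "\<And>y. f xstar \<le> f y"
    and "\<And>s. s \<in> space D \<Longrightarrow> smooth_with L (\<lambda>y. F y s)"
    and "\<And>y. integrable D (\<lambda>s. (F y s - f y)\<^sup>2)"
    and "\<And>y. (\<integral>s. (F y s - f y)\<^sup>2 \<partial>D) \<le> \<sigma>0\<^sup>2"
    and "\<And>y. integrable D (\<lambda>s. (norm (gradient (\<lambda>z. F z s) y - gradient f y))\<^sup>2)"
    and "\<And>y. (\<integral>s. (norm (gradient (\<lambda>z. F z s) y - gradient f y))\<^sup>2 \<partial>D) \<le> \<sigma>1\<^sup>2"
    and "prob_space M"
    and "T \<ge> 1"
    and "prob_space.indep_vars M (\<lambda>_. borel) u {0..T}"
    and "\<And>t. t \<in> {0..T} \<Longrightarrow> distr M borel (u t) = uniform_unit_sphere"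
    and "prob_space.indep_vars M (\<lambda>_. D) \<xi> {0..T}"
    and "\<And>t. t \<in> {0..T} \<Longrightarrow> distr M D (\<xi> t) = D"
    and "indep_pair M
           (PiM {0..T} (\<lambda>_. borel)) (\<lambda>\<omega>. \<lambda>t\<in>{0..T}. u t \<omega>)
           (PiM {0..T} (\<lambda>_. D)) (\<lambda>\<omega>. \<lambda>t\<in>{0..T}. \<xi> t \<omega>)"
    and "\<alpha> > 0" and "\<eta> > 0"
    and "\<eta> \<le> min (\<alpha> / (8 * real DIM('a) * L0)) (1 / (64 * real DIM('a) * L))"
    and "\<And>t \<omega>. x t \<omega> = residual_iterate F \<alpha> \<eta> x1 (\<lambda>i. u i \<omega>) (\<lambda>i. \<xi> i \<omega>) t"
  shows "(\<forall>t\<in>{1..T}. integrable M (\<lambda>\<omega>. f (x t \<omega>) - f xstar)) \<and>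
    (1 / real T) * (\<Sum>t=1..T. (\<integral>\<omega>. (f (x t \<omega>) - f xstar) \<partial>M))
      \<le> (norm (x1 - xstar))\<^sup>2 / (\<eta> * real T)
        + 20 * \<eta> * (real DIM('a))\<^sup>2 * L\<^sup>2 * \<alpha>\<^sup>2
        + 16 * \<eta> * real DIM('a) * L0\<^sup>2 / real T
        + L * \<alpha>\<^sup>2 / 2
        + 128 * (real DIM('a))\<^sup>2 * \<sigma>0\<^sup>2 * \<eta> / \<alpha>\<^sup>2
        + 64 * real DIM('a) * \<eta> * \<sigma>1\<^sup>2"
proof -
  interpret D: prob_space D by fact
  interpret M: prob_space M by fact
  have objective: "stochastic_objective D F f L0 L \<sigma>0 \<sigma>1 xstar"
    by unfold_locales (use assms in auto)
  interpret S: stochastic_objective D F f L0 L \<sigma>0 \<sigma>1 xstar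
    by (rule objective)
  define W where "W t \<omega> = (u t \<omega>, \<xi> t \<omega>)" for t \<omega>
  have u: "u t \<in> borel_measurable M" and \<xi>: "\<xi> t \<in> measurable M D" if "t \<in> {0..T}" for t
    using assms(18,20) that by (auto simp: M.indep_vars_def)
  have W_indep: "M.indep_vars (\<lambda>_. borel \<Otimes>\<^sub>M D) W {0..T}"
    unfolding W_def[abs_def] by (rule M.indep_vars_Pair) (use assms(18,20,22) in auto)
  have W_law: "distr M (borel \<Otimes>\<^sub>M D) (W t) = uniform_unit_sphere \<Otimes>\<^sub>M D" if t: "t \<in> {0..T}" for t
  proof -
    have "distr M (borel \<Otimes>\<^sub>M D) (W t) = distr M borel (u t) \<Otimes>\<^sub>M distr M D (\<xi> t)"
      unfolding W_def[abs_def]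
      by (rule M.distr_Pair_eqI[OF u[OF t] \<xi>[OF t]]) (rule M.indep_pair_component[OF assms(22) t])
    with assms(19,21) t show ?thesis
      by simp
  qed
  interpret R: residual_feedback D F f L0 L \<sigma>0 \<sigma>1 xstar M W T \<alpha> \<eta> x1
    by unfold_locales (use W_indep W_law assms in \<open>auto simp: atLeast0AtMost\<close>)
  have x: "x t \<omega> = R.X t \<omega>" for t \<omega>
    by (simp add: assms(26) R.X_def W_def)
  show ?thesis
    unfolding x using R.integrable_gap R.average_gap_bound assms by auto
qed

end
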